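(* Let $\bar x\in\Phi$ be a local second-order weak sharp minimizer of problem (P) with corresponding constants $\kappa>0$ and $\delta>0$, and suppose that MSCQ holds at $\bar x$ for the system $g(x)\in K$. Then for any $\varepsilon\in[0,1/2)$ there exists $\delta'\in(0,\delta)$ such that for every $x\in S\cap B_{\delta'}(\bar x)$ and every $d\in C(x)\cap N^{P,\varepsilon}_S(x)$: (i) there exists $\lambda\in\Lambda(x;d)$ such that for every set $A\supset\Theta(x;d)$ one has $\hat\sigma_{T''_K(g(x);\nabla g(x)d),A}(\lambda)\le0$; in particular $\hat\sigma_{T''_K(g(x);\nabla g(x)d)}(\lambda)\le0$; (ii) if $T^2_K(g(x);\nabla g(x)d)\neq\emptyset$, then there exists $\lambda\in\Lambda(x;d)$ such that for every set $B\supset\Omega(x;d)$, $\nabla^2_{xx}L(x,\lambda)(d,d)-\hat\sigma_{T^2_K(g(x);\nabla g(x)d),B}(\lambda)\ge2\kappa(1-2\varepsilon)^2\|d\|^2$; in particular $\nabla^2_{xx}L(x,\lambda)(d,d)-\hat\sigma_{T^2_K(g(x);\nabla g(x)d)}(\lambda)\ge2\kappa(1-2\varepsilon)^2\|d\|^2$. Moreover, for every $x\in S\cap B_{\delta'}(\bar x)$ and every $d\in C(x)$ (not necessarily an $\varepsilon$-proximal normal), (i) holds and (ii) holds with the right-hand side $2\kappa(1-2\varepsilon)^2\|d\|^2$ replaced by $2\kappa[\mathrm{dist}(d,T_S(x))]^2$ in both inequalities.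
   Context: Standing setting: $f:\mathbb{R}^n\to\mathbb{R}$, $g:\mathbb{R}^n\to\mathbb{R}^m$ twice continuously differentiable, $K\subset\mathbb{R}^m$ closed; (P) is $\min f(x)$ s.t. $g(x)\in K$; $\Phi:=\{x:g(x)\in K\}$; $S$ is the (nonempty) set of optimal solutions of (P); $L(x,\lambda):=f(x)+\langle g(x),\lambda\rangle$. $\bar x\in\Phi$ is a local second-order weak sharp minimizer with constants $\kappa,\delta>0$ if $f(x)\ge f(\bar x)+\kappa[\mathrm{dist}(x,S)]^2$ for all $x\in\Phi\cap B_\delta(\bar x)$. MSCQ holds at $\bar x$ if there are $\delta_0,\kappa_0>0$ with $\mathrm{dist}(x,\Phi)\le\kappa_0\,\mathrm{dist}(g(x),K)$ for all $x\in B_{\delta_0}(\bar x)$. For a closed set $A$ and $\bar x\in A$: $T_A(\bar x):=\{d:\exists t_k\downarrow0,d_k\to d,\bar x+t_kd_k\in A\}$; for $d\in T_A(\bar x)$, $T^2_A(\bar x;d):=\{w:\exists t_k\downarrow0,w_k\to w,\bar x+t_kd+\tfrac12t_k^2w_k\in A\}$, $T''_A(\bar x;d):=\{w:\exists(t_k,r_k)\downarrow(0,0),t_k/r_k\to0,w_k\to w,\bar x+t_kd+\tfrac12t_kr_kw_k\in A\}$. $C(x):=\{d:\nabla g(x)d\in T_K(g(x)),\nabla f(x)d\le0\}$. Proximal normal cone $N^P_A(\bar x):=\{v:\exists\tau>0,\ \bar x\text{ is a nearest point of }A\text{ to }\bar x+\tau v\}$; $N^{P,\varepsilon}_A(\bar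 x):=\{v:\mathrm{dist}(v,N^P_A(\bar x))\le\varepsilon\|v\|\}$. Fréchet normal cone $\hat N_A(\bar x):=\{v:\limsup_{x\to\bar x,x\in A}\langle v,x-\bar x\rangle/\|x-\bar x\|\le0\}$ (empty if $\bar x\notin A$); limiting normal cone $N_A(\bar x):=\{v:\exists x_k\to\bar x, x_k\in A, v_k\to v, v_k\in\hat N_A(x_k)\}$; directional limiting normal cone $N_A(\bar x;d):=\{v:\exists t_k\downarrow0,d_k\to d,v_k\to v,\ v_k\in\hat N_A(\bar x+t_kd_k)\}$. Directional M-multiplier set: $\Lambda(x;d):=\{\lambda\in\mathbb{R}^m:\nabla_xL(x,\lambda)=0,\ \lambda\in N_K(g(x);\nabla g(x)d)\}$. $\Theta(x;d):=\nabla g(x)(T''_\Phi(x;d))$ and $\Omega(x;d):=\nabla g(x)(T^2_\Phi(x;d))+\nabla^2g(x)(d,d)$, where $\nabla^2g(x)(d,d):=(d^T\nabla^2g_i(x)d)_{i=1}^m$ and $\nabla g(x)(A):=\{\nabla g(x)u:u\in A\}$. Lower generalized support function: for a nonempty closed $D\subset\mathbb{R}^m$ and $A\subset\mathbb{R}^m$, $\hat\sigma_{D,A}(\lambda):=\liminf_{\lambda'\to\lambda}\inf\{\langle\lambda',u\rangle: u\in A,\ \lambda'\in N_D(u)\}$ (with $\inf\emptyset=+\infty$); if $D=\emptyset$, $\hat\sigma_{D,A}\equiv-\infty$; $\hat\sigma_D:=\hat\sigma_{D,\mathbb{R}^m}$. *)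

theory Defs
  imports "HOL-Analysis.Analysis"
begin

definition tangent_cone :: "'a::real_normed_vector set \<Rightarrow> 'a \<Rightarrow> 'a set" where
  "tangent_cone A x = {d. \<exists>t dd. (\<forall>k. t k > (0::real)) \<and> t \<longlonglongrightarrow> 0 \<and> dd \<longlonglongrightarrow> d
       \<and> (\<forall>k. x + t k *\<^sub>R dd k \<in> A)}"

definition second_tangent :: "'a::real_normed_vector set \<Rightarrow> 'a \<Rightarrow> 'a \<Rightarrow> 'a set" where
  "second_tangent A x d = {w. \<exists>t ww. (\<forall>k. t k > (0::real)) \<and> t \<longlonglongrightarrow> 0 \<and> ww \<longlonglongrightarrow> w
       \<and> (\<forall>k. x + t k *\<^sub>R d + ((t k)\<^sup>2 / 2) *\<^sub>R ww k \<in> A)}"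

definition asymp_second_tangent :: "'a::real_normed_vector set \<Rightarrow> 'a \<Rightarrow> 'a \<Rightarrow> 'a set" where
  "asymp_second_tangent A x d = {w. \<exists>t r ww. (\<forall>k. t k > (0::real) \<and> r k > 0)
       \<and> t \<longlonglongrightarrow> 0 \<and> r \<longlonglongrightarrow> 0 \<and> (\<lambda>k. t k / r k) \<longlonglongrightarrow> 0 \<and> ww \<longlonglongrightarrow> w
       \<and> (\<forall>k. x + t k *\<^sub>R d + (t k * r k / 2) *\<^sub>R ww k \<in> A)}"

definition proximal_normal :: "'a::real_inner set \<Rightarrow> 'a \<Rightarrow> 'a set" where
  "proximal_normal A x = {v. x \<in> A \<and> (\<exists>\<tau>>0. \<forall>a\<in>A. dist (x + \<tau> *\<^sub>R v) x \<le> dist (x + \<tau> *\<^sub>R v) a)}"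

definition eps_proximal_normal :: "'a::real_inner set \<Rightarrow> 'a \<Rightarrow> real \<Rightarrow> 'a set" where
  "eps_proximal_normal A x \<epsilon> = {v. infdist v (proximal_normal A x) \<le> \<epsilon> * norm v}"

text \<open>Frechet normal cone (limsup condition written out; empty outside A).\<close>
definition frechet_normal :: "'a::real_inner set \<Rightarrow> 'a \<Rightarrow> 'a set" where
  "frechet_normal A x = {v. x \<in> A \<and> (\<forall>e>0. \<exists>r>0. \<forall>y\<in>A. norm (y - x) < r \<longrightarrow>
        inner v (y - x) \<le> e * norm (y - x))}"

definition limiting_normal :: "'a::real_inner set \<Rightarrow> 'a \<Rightarrow> 'a set" where
  "limiting_normal A x = {v. \<exists>xs vs. (\<forall>k. xs k \<in> A \<and> vs k \<in> frechet_normal A (xs k))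
        \<and> xs \<longlonglongrightarrow> x \<and> vs \<longlonglongrightarrow> v}"

definition dir_normal :: "'a::real_inner set \<Rightarrow> 'a \<Rightarrow> 'a \<Rightarrow> 'a set" where
  "dir_normal A x d = {v. \<exists>t dd vs. (\<forall>k. t k > (0::real)) \<and> t \<longlonglongrightarrow> 0 \<and> dd \<longlonglongrightarrow> d
        \<and> vs \<longlonglongrightarrow> v \<and> (\<forall>k. vs k \<in> frechet_normal A (x + t k *\<^sub>R dd k))}"

text \<open>Lower generalized support function (value in extended reals; liminf taken in
  the Rockafellar--Wets sense, the point itself included; INF of the empty set is +infinity).\<close>
definition lower_gen_support :: "'a::real_inner set \<Rightarrow> 'a set \<Rightarrow> 'a \<Rightarrow> ereal" where
  "lower_gen_support D A l =
     (if D = {} then -\<infinity>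
      else (SUP r\<in>{0<..}. INF l'\<in>ball l r.
              INF u\<in>{u\<in>A. l' \<in> limiting_normal D u}. ereal (inner l' u)))"

definition feasible_set :: "('a \<Rightarrow> 'b) \<Rightarrow> 'b set \<Rightarrow> 'a set" where
  "feasible_set g K = {x. g x \<in> K}"

definition optimal_set :: "('a \<Rightarrow> real) \<Rightarrow> ('a \<Rightarrow> 'b) \<Rightarrow> 'b set \<Rightarrow> 'a set" where
  "optimal_set f g K = {x. g x \<in> K \<and> (\<forall>y. g y \<in> K \<longrightarrow> f x \<le> f y)}"

definition so_weak_sharp_min ::
  "('a::real_normed_vector \<Rightarrow> real) \<Rightarrow> ('a \<Rightarrow> 'b) \<Rightarrow> 'b set \<Rightarrow> 'a \<Rightarrow> real \<Rightarrow> real \<Rightarrow> bool" where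
  "so_weak_sharp_min f g K xb \<kappa> \<delta> \<longleftrightarrow> xb \<in> feasible_set g K \<and> \<kappa> > 0 \<and> \<delta> > 0 \<and>
     (\<forall>x \<in> feasible_set g K \<inter> ball xb \<delta>. f x \<ge> f xb + \<kappa> * (infdist x (optimal_set f g K))\<^sup>2)"

definition MSCQ :: "('a::real_normed_vector \<Rightarrow> 'b::real_normed_vector) \<Rightarrow> 'b set \<Rightarrow> 'a \<Rightarrow> bool" where
  "MSCQ g K xb \<longleftrightarrow> (\<exists>\<delta>0>0. \<exists>\<kappa>0>0. \<forall>x\<in>ball xb \<delta>0.
      infdist x (feasible_set g K) \<le> \<kappa>0 * infdist (g x) K)"

text \<open>Critical cone C(x); Df x, Dg x are the (Frechet) derivatives of f, g at x.\<close>
definition crit_cone ::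
  "('a::real_normed_vector \<Rightarrow> 'a \<Rightarrow>\<^sub>L real) \<Rightarrow> ('a \<Rightarrow> 'b::real_normed_vector) \<Rightarrow> ('a \<Rightarrow> 'a \<Rightarrow>\<^sub>L 'b)
     \<Rightarrow> 'b set \<Rightarrow> 'a \<Rightarrow> 'a set" where
  "crit_cone Df g Dg K x = {d. Dg x d \<in> tangent_cone K (g x) \<and> Df x d \<le> 0}"

definition dir_multipliers ::
  "('a::real_normed_vector \<Rightarrow> 'a \<Rightarrow>\<^sub>L real) \<Rightarrow> ('a \<Rightarrow> 'b::real_inner) \<Rightarrow> ('a \<Rightarrow> 'a \<Rightarrow>\<^sub>L 'b)
     \<Rightarrow> 'b set \<Rightarrow> 'a \<Rightarrow> 'a \<Rightarrow> 'b set" where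
  "dir_multipliers Df g Dg K x d = {l. (\<forall>u. Df x u + inner (Dg x u) l = 0)
        \<and> l \<in> dir_normal K (g x) (Dg x d)}"

definition Theta_set :: "('a::real_normed_vector \<Rightarrow> 'b::real_normed_vector) \<Rightarrow> ('a \<Rightarrow> 'a \<Rightarrow>\<^sub>L 'b)
     \<Rightarrow> 'b set \<Rightarrow> 'a \<Rightarrow> 'a \<Rightarrow> 'b set" where
  "Theta_set g Dg K x d = (\<lambda>u. Dg x u) ` asymp_second_tangent (feasible_set g K) x d"

definition Omega_set :: "('a::real_normed_vector \<Rightarrow> 'b::real_normed_vector) \<Rightarrow> ('a \<Rightarrow> 'a \<Rightarrow>\<^sub>L 'b)
     \<Rightarrow> ('a \<Rightarrow> 'a \<Rightarrow>\<^sub>L 'a \<Rightarrow>\<^sub>L 'b) \<Rightarrow> 'b set \<Rightarrow> 'a \<Rightarrow> 'a \<Rightarrow> 'b set" where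
  "Omega_set g Dg D2g K x d = (\<lambda>u. Dg x u + D2g x d d) ` second_tangent (feasible_set g K) x d"

definition lagr_hess :: "('a::real_normed_vector \<Rightarrow> 'a \<Rightarrow>\<^sub>L 'a \<Rightarrow>\<^sub>L real)
     \<Rightarrow> ('a \<Rightarrow> 'a \<Rightarrow>\<^sub>L 'a \<Rightarrow>\<^sub>L 'b::real_inner) \<Rightarrow> 'a \<Rightarrow> 'b \<Rightarrow> 'a \<Rightarrow> real" where
  "lagr_hess D2f D2g x l d = D2f x d d + inner (D2g x d d) l"

end

theory Submission
  imports Defs
begin

text \<open>Let \<open>D\<close> be the second-order (or asymptotic second-order) tangent set of \<open>K\<close> in direction
  \<open>\<nabla>g(x)d\<close>, and put \<open>a = \<nabla>\<^sup>2g(x)(d,d)\<close> (or \<open>a = 0\<close>). Metric subregularity shows that the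
  corresponding tangent set of the feasible set is \<open>{w. a + \<nabla>g(x)w \<in> D}\<close>, with a Lipschitz error bound.
  Quadratic growth bounds \<open>\<nabla>f(x)w\<close> from below on this set. Minimising
  \<open>\<nabla>f(x)w + e|w|\<^sup>2/2\<close> there by quadratic penalisation yields multipliers that are limits of proximal
  normals to \<open>D\<close> and that are bounded by the error bound; letting \<open>e \<rightarrow> 0\<close> gives the multiplier of the
  theorem. Projecting onto blow-ups of \<open>K\<close> shows that proximal normals to \<open>D\<close> are directional
  limiting normals to \<open>K\<close>. Finally, an \<open>\<epsilon>\<close>-proximal normal \<open>d\<close> has distance at least
  \<open>(1 - 2\<epsilon>)|d|\<close> to the tangent cone of the solution set, since proximal normals are polar to it.\<close>

section \<open>Tangent sets of order between one and two\<close>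

text \<open>The values \<open>\<gamma> = 1\<close> and \<open>\<gamma> = 0\<close> give the outer and the asymptotic second-order
  tangent set, so that both parts of the theorem become one statement.\<close>

definition scaled_tangent :: "real \<Rightarrow> 'a::real_normed_vector set \<Rightarrow> 'a \<Rightarrow> 'a \<Rightarrow> 'a set" where
  "scaled_tangent \<gamma> A x d = {w. \<forall>e>0. \<exists>t s w'. 0 < t \<and> t < e \<and> 0 < s \<and> s / t < e \<and>
      \<bar>t\<^sup>2 / (2 * s) - \<gamma>\<bar> < e \<and> norm (w' - w) < e \<and> x + t *\<^sub>R d + s *\<^sub>R w' \<in> A}"

text \<open>Taking \<open>e = 1/(k+1)\<close> in the neighbourhood form of the definition recovers
  sequences, the form suited to compactness and expansion arguments.\<close>

lemma scaled_tangentE: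
  assumes "w \<in> scaled_tangent \<gamma> A x d"
  obtains t s ww where "\<And>k::nat. t k > 0" "\<And>k. s k > 0" "t \<longlonglongrightarrow> 0" "(\<lambda>k. s k / t k) \<longlonglongrightarrow> 0"
    "(\<lambda>k. (t k)\<^sup>2 / (2 * s k)) \<longlonglongrightarrow> \<gamma>" "ww \<longlonglongrightarrow> w"
    "\<And>k. x + t k *\<^sub>R d + s k *\<^sub>R ww k \<in> A"
proof -
  let ?e = "\<lambda>k::nat. inverse (real (Suc k))"
  have "\<forall>k. \<exists>t s w'. 0 < t \<and> t < ?e k \<and> 0 < s \<and> s / t < ?e k \<and>
      \<bar>t\<^sup>2 / (2 * s) - \<gamma>\<bar> < ?e k \<and> norm (w' - w) < ?e k \<and> x + t *\<^sub>R d + s *\<^sub>R w' \<in> A"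
    using assms unfolding scaled_tangent_def by auto
  then obtain t s ww where *: "\<And>k. 0 < t k \<and> t k < ?e k \<and> 0 < s k \<and> s k / t k < ?e k \<and>
      \<bar>(t k)\<^sup>2 / (2 * s k) - \<gamma>\<bar> < ?e k \<and> norm (ww k - w) < ?e k \<and> x + t k *\<^sub>R d + s k *\<^sub>R ww k \<in> A"
    by metis
  have e: "?e \<longlonglongrightarrow> 0" by (rule LIMSEQ_inverse_real_of_nat)
  show ?thesis
  proof
    show "t \<longlonglongrightarrow> 0"
      by (rule Lim_null_comparison[OF always_eventually e]) (use * in \<open>auto simp: less_imp_le abs_of_pos\<close>)
    show "(\<lambda>k. s k / t k) \<longlonglongrightarrow> 0"
      by (rule Lim_null_comparison[OF always_eventually e]) (use * in \<open>auto simp: less_imp_le abs_of_pos\<close>)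
    show "(\<lambda>k. (t k)\<^sup>2 / (2 * s k)) \<longlonglongrightarrow> \<gamma>"
      by (rule LIM_zero_cancel, rule Lim_null_comparison[OF always_eventually e])
        (use * in \<open>auto simp: less_imp_le\<close>)
    show "ww \<longlonglongrightarrow> w"
      by (rule LIM_zero_cancel, rule Lim_null_comparison[OF always_eventually e])
        (use * in \<open>auto simp: less_imp_le\<close>)
  qed (use * in auto)
qed

lemma scaled_tangentI:
  assumes "\<And>k::nat. t k > 0" "\<And>k. s k > 0" "t \<longlonglongrightarrow> 0" "(\<lambda>k. s k / t k) \<longlonglongrightarrow> 0"
    "(\<lambda>k. (t k)\<^sup>2 / (2 * s k)) \<longlonglongrightarrow> \<gamma>" "ww \<longlonglongrightarrow> w"
    "\<And>k. x + t k *\<^sub>R d + s k *\<^sub>R ww k \<in> A"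
  shows "w \<in> scaled_tangent \<gamma> A x d"
  unfolding scaled_tangent_def
proof (intro CollectI allI impI)
  fix e :: real assume "e > 0"
  have "\<forall>\<^sub>F k in sequentially. t k < e \<and> s k / t k < e \<and>
      dist ((t k)\<^sup>2 / (2 * s k)) \<gamma> < e \<and> dist (ww k) w < e"
    using \<open>e > 0\<close> assms by (intro eventually_conj order_tendstoD(2)[OF assms(3)]
        order_tendstoD(2)[OF assms(4)] tendstoD[OF assms(5)] tendstoD[OF assms(6)])
  then obtain k where "t k < e \<and> s k / t k < e \<and> dist ((t k)\<^sup>2 / (2 * s k)) \<gamma> < e \<and> dist (ww k) w < e"
    using eventually_happens'[OF sequentially_bot] by blast
  then show "\<exists>t s w'. 0 < t \<and> t < e \<and> 0 < s \<and> s / t < e \<and>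
      \<bar>t\<^sup>2 / (2 * s) - \<gamma>\<bar> < e \<and> norm (w' - w) < e \<and> x + t *\<^sub>R d + s *\<^sub>R w' \<in> A"
    using assms by (intro exI[of _ "t k"] exI[of _ "s k"] exI[of _ "ww k"]) (auto simp: dist_norm)
qed

text \<open>The neighbourhood form reduces this to halving \<open>e\<close>, with no diagonal
  sequence. Closedness later provides nearest points in the tangent set of \<open>K\<close>.\<close>

lemma closed_scaled_tangent: "closed (scaled_tangent \<gamma> A x d)"
proof -
  have "w \<in> scaled_tangent \<gamma> A x d" if "w \<in> closure (scaled_tangent \<gamma> A x d)" for w
    unfolding scaled_tangent_def
  proof (intro CollectI allI impI)
    fix e :: real assume e: "e > 0"
    obtain v where v: "v \<in> scaled_tangent \<gamma> A x d" "dist v w < e/2"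
      using \<open>w \<in> closure _\<close> e unfolding closure_approachable by (meson half_gt_zero)
    from v(1) half_gt_zero[OF e] obtain t s w' where "0 < t" "t < e/2" "0 < s" "s / t < e/2"
      "\<bar>t\<^sup>2 / (2 * s) - \<gamma>\<bar> < e/2" "norm (w' - v) < e/2" "x + t *\<^sub>R d + s *\<^sub>R w' \<in> A"
      unfolding scaled_tangent_def mem_Collect_eq by blast
    moreover have "norm (w' - w) < e"
      using norm_triangle_ineq[of "w' - v" "v - w"] calculation(6) v(2) by (simp add: dist_norm)
    ultimately show "\<exists>t s w'. 0 < t \<and> t < e \<and> 0 < s \<and> s / t < e \<and>
      \<bar>t\<^sup>2 / (2 * s) - \<gamma>\<bar> < e \<and> norm (w' - w) < e \<and> x + t *\<^sub>R d + s *\<^sub>R w' \<in> A"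
      using e by (intro exI[of _ t] exI[of _ s] exI[of _ w']) linarith
  qed
  then show ?thesis using closure_subset_eq by blast
qed

text \<open>With \<open>\<gamma> = 1\<close> the scale \<open>s\<close> equals \<open>t^2/2\<close>
  up to a factor tending to 1, and that factor can be moved into the second-order
  directions.\<close>

lemma second_tangent_eq: "second_tangent A x d = scaled_tangent 1 A x d"
proof (intro equalityI subsetI)
  fix w assume "w \<in> second_tangent A x d"
  then obtain t ww where *: "\<And>k. t k > (0::real)" "t \<longlonglongrightarrow> 0" "ww \<longlonglongrightarrow> w"
      "\<And>k. x + t k *\<^sub>R d + ((t k)\<^sup>2 / 2) *\<^sub>R ww k \<in> A"
    unfolding second_tangent_def by blast
  have "(\<lambda>k. t k / 2) \<longlonglongrightarrow> 0" using tendsto_divide[OF *(2) tendsto_const[of 2]] by simp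
  moreover have "(t k)\<^sup>2 / 2 / t k = t k / 2" for k using *(1)[of k] by (simp add: power2_eq_square)
  moreover have "(t k)\<^sup>2 / (2 * ((t k)\<^sup>2 / 2)) = 1" for k using *(1)[of k] by simp
  ultimately show "w \<in> scaled_tangent 1 A x d"
    using * by (intro scaled_tangentI[of t "\<lambda>k. (t k)\<^sup>2 / 2" _ ww]) (simp_all only:, simp_all add: less_imp_neq[symmetric])
next
  fix w assume "w \<in> scaled_tangent 1 A x d"
  then obtain t s ww where *: "\<And>k::nat. t k > 0" "\<And>k. s k > 0" "t \<longlonglongrightarrow> 0"
    "(\<lambda>k. s k / t k) \<longlonglongrightarrow> 0" "(\<lambda>k. (t k)\<^sup>2 / (2 * s k)) \<longlonglongrightarrow> 1" "ww \<longlonglongrightarrow> w"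
    "\<And>k. x + t k *\<^sub>R d + s k *\<^sub>R ww k \<in> A" by (rule scaled_tangentE) blast
  have "(\<lambda>k. inverse ((t k)\<^sup>2 / (2 * s k)) *\<^sub>R ww k) \<longlonglongrightarrow> inverse 1 *\<^sub>R w"
    by (intro tendsto_intros *) auto
  moreover have "x + t k *\<^sub>R d + ((t k)\<^sup>2 / 2) *\<^sub>R (inverse ((t k)\<^sup>2 / (2 * s k)) *\<^sub>R ww k) \<in> A" for k
    using *(7)[of k] *(1)[of k] *(2)[of k] by simp
  ultimately show "w \<in> second_tangent A x d"
    unfolding second_tangent_def using *
    by (intro CollectI exI[of _ t] exI[of _ "\<lambda>k. inverse ((t k)\<^sup>2 / (2 * s k)) *\<^sub>R ww k"])
      (simp only:, simp)
qed

text \<open>The parametrisations correspond through \<open>s = t r / 2\<close>, so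
  \<open>r = 2 s / t\<close> and \<open>t / r = t^2 / (2 s)\<close>; vanishing of that ratio is the
  case \<open>\<gamma> = 0\<close>.\<close>

lemma asymp_second_tangent_eq: "asymp_second_tangent A x d = scaled_tangent 0 A x d"
proof (intro equalityI subsetI)
  fix w assume "w \<in> asymp_second_tangent A x d"
  then obtain t r ww where *: "\<And>k. t k > (0::real)" "\<And>k. r k > 0" "t \<longlonglongrightarrow> 0" "r \<longlonglongrightarrow> 0"
      "(\<lambda>k. t k / r k) \<longlonglongrightarrow> 0" "ww \<longlonglongrightarrow> w" "\<And>k. x + t k *\<^sub>R d + (t k * r k / 2) *\<^sub>R ww k \<in> A"
    unfolding asymp_second_tangent_def by blast
  have "(\<lambda>k. r k / 2) \<longlonglongrightarrow> 0" using tendsto_divide[OF *(4) tendsto_const[of 2]] by simp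
  moreover have "t k * r k / 2 / t k = r k / 2" for k using *(1)[of k] by simp
  moreover have "(t k)\<^sup>2 / (2 * (t k * r k / 2)) = t k / r k" for k
    using *(1)[of k] *(2)[of k] by (simp add: power2_eq_square)
  ultimately show "w \<in> scaled_tangent 0 A x d"
    using * by (intro scaled_tangentI[of t "\<lambda>k. t k * r k / 2" _ ww]) (simp_all only:, simp_all)
next
  fix w assume "w \<in> scaled_tangent 0 A x d"
  then obtain t s ww where *: "\<And>k::nat. t k > 0" "\<And>k. s k > 0" "t \<longlonglongrightarrow> 0"
    "(\<lambda>k. s k / t k) \<longlonglongrightarrow> 0" "(\<lambda>k. (t k)\<^sup>2 / (2 * s k)) \<longlonglongrightarrow> 0" "ww \<longlonglongrightarrow> w"
    "\<And>k. x + t k *\<^sub>R d + s k *\<^sub>R ww k \<in> A" by (rule scaled_tangentE) blast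
  have "(\<lambda>k. 2 * (s k / t k)) \<longlonglongrightarrow> 0" using tendsto_mult[OF tendsto_const[of 2] *(4)] by simp
  moreover have "t k / (2 * (s k / t k)) = (t k)\<^sup>2 / (2 * s k)" for k
    using *(1)[of k] by (simp add: power2_eq_square)
  moreover have "t k * (2 * (s k / t k)) / 2 = s k" for k using *(1)[of k] by simp
  ultimately show "w \<in> asymp_second_tangent A x d"
    unfolding asymp_second_tangent_def using *
    by (intro CollectI exI[of _ t] exI[of _ "\<lambda>k. 2 * (s k / t k)"] exI[of _ ww])
      (simp only:, simp)
qed

text \<open>Supplies the nonemptiness behind part (i). The first-order error
  \<open>t (dd - d)\<close> is read as a second-order term \<open>s ww\<close> with
  \<open>s = t q\<close> and \<open>ww\<close> tending to 0.\<close>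

lemma zero_in_scaled_tangent_0:
  assumes "d \<in> tangent_cone A x"
  shows "0 \<in> scaled_tangent 0 A x d"
proof -
  obtain t dd where *: "\<And>k. t k > (0::real)" "t \<longlonglongrightarrow> 0" "dd \<longlonglongrightarrow> d" "\<And>k. x + t k *\<^sub>R dd k \<in> A"
    using assms unfolding tangent_cone_def by blast
  \<comment> \<open>A scale tending to 0 more slowly than both \<open>t k\<close> and
    \<open>norm (dd k - d)\<close>, thanks to the square roots; the first summand keeps
    \<open>q k\<close> positive even where \<open>dd k = d\<close>.\<close>
  define q where "q k = sqrt (t k) + sqrt (norm (dd k - d))" for k
  have q: "q k > 0" for k using *(1)[of k] by (simp add: q_def add_pos_nonneg)
  have nd: "(\<lambda>k. norm (dd k - d)) \<longlonglongrightarrow> 0"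
    using *(3) by (simp add: LIM_zero tendsto_norm_zero)
  have st: "(\<lambda>k. sqrt (t k)) \<longlonglongrightarrow> 0" and sd: "(\<lambda>k. sqrt (norm (dd k - d))) \<longlonglongrightarrow> 0"
    using tendsto_real_sqrt[OF *(2)] tendsto_real_sqrt[OF nd] by simp_all
  have q0: "q \<longlonglongrightarrow> 0" using tendsto_add[OF st sd] by (simp add: q_def[abs_def])
  show ?thesis
  proof (rule scaled_tangentI[where t=t and s="\<lambda>k. t k * q k" and ww="\<lambda>k. (1 / q k) *\<^sub>R (dd k - d)"])
    show "(\<lambda>k. t k * q k / t k) \<longlonglongrightarrow> 0" using q0 *(1) by (simp add: less_imp_neq[symmetric])
    have "(t k)\<^sup>2 / (2 * (t k * q k)) \<le> sqrt (t k)" for k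
    proof -
      have "t k = sqrt (t k) * sqrt (t k)" using *(1)[of k] by simp
      also have "\<dots> \<le> sqrt (t k) * q k" unfolding q_def using *(1)[of k] by (intro mult_left_mono) auto
      also have "\<dots> \<le> sqrt (t k) * q k * 2" using q[of k] *(1)[of k] by simp
      finally have "t k / (2 * q k) \<le> sqrt (t k)" using q[of k] by (simp add: field_simps)
      moreover have "(t k)\<^sup>2 / (2 * (t k * q k)) = t k / (2 * q k)"
        using *(1)[of k] q[of k] by (simp add: power2_eq_square)
      ultimately show ?thesis by simp
    qed
    moreover have "(t k)\<^sup>2 / (2 * (t k * q k)) \<ge> 0" for k using *(1)[of k] q[of k] by simp
    ultimately show "(\<lambda>k. (t k)\<^sup>2 / (2 * (t k * q k))) \<longlonglongrightarrow> 0"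
      by (intro Lim_null_comparison[OF always_eventually st]) (simp only: real_norm_def abs_of_nonneg, simp)
    have "norm ((1 / q k) *\<^sub>R (dd k - d)) \<le> sqrt (norm (dd k - d))" for k
    proof -
      have "norm (dd k - d) = sqrt (norm (dd k - d)) * sqrt (norm (dd k - d))" by simp
      also have "\<dots> \<le> sqrt (norm (dd k - d)) * q k" unfolding q_def using *(1)[of k] by (intro mult_left_mono) auto
      finally show ?thesis using q[of k] by (simp add: divide_le_eq)
    qed
    then show "(\<lambda>k. (1 / q k) *\<^sub>R (dd k - d)) \<longlonglongrightarrow> 0"
      by (intro Lim_null_comparison[OF always_eventually sd]) simp
    show "x + t k *\<^sub>R d + (t k * q k) *\<^sub>R (1 / q k) *\<^sub>R (dd k - d) \<in> A" for k
      using *(4)[of k] q[of k] by (simp add: algebra_simps)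
  qed (use * q in auto)
qed

section \<open>Second-order expansions\<close>

text \<open>Mean value estimate for the remainder along the segment from \<open>x\<close> to
  \<open>x + h\<close>: its derivative is the first-order remainder of \<open>Dg\<close> at
  \<open>x\<close>, applied to \<open>h\<close>.\<close>

lemma second_order_taylor:
  fixes g :: "'a::real_normed_vector \<Rightarrow> 'b::real_normed_vector"
  assumes g1: "\<And>x. (g has_derivative blinfun_apply (Dg x)) (at x)"
    and g2: "(Dg has_derivative blinfun_apply D2) (at x)"
    and e: "e > 0"
  shows "\<exists>r>0. \<forall>h. norm h < r \<longrightarrow>
    norm (g (x + h) - g x - Dg x h - (1/2) *\<^sub>R D2 h h) \<le> e * (norm h)\<^sup>2"
proof -
  from g2 e obtain r where r: "r > 0" and
    R: "\<And>y. norm (y - x) < r \<Longrightarrow> norm (Dg y - Dg x - D2 (y - x)) \<le> e * norm (y - x)"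
    unfolding has_derivative_at_alt by blast
  have "norm (g (x + h) - g x - Dg x h - (1/2) *\<^sub>R D2 h h) \<le> e * (norm h)\<^sup>2" if h: "norm h < r" for h
  proof -
    \<comment> \<open>The constant \<open>g x\<close> is left out because only
      \<open>\<phi> 1 - \<phi> 0\<close> matters, and it equals the full remainder.\<close>
    define \<phi> where "\<phi> \<tau> = g (x + \<tau> *\<^sub>R h) - \<tau> *\<^sub>R Dg x h - (\<tau>\<^sup>2 / 2) *\<^sub>R D2 h h" for \<tau> :: real
    define \<phi>' where "\<phi>' \<tau> v = v *\<^sub>R (Dg (x + \<tau> *\<^sub>R h) - Dg x - D2 (\<tau> *\<^sub>R h)) h" for \<tau> v :: real
    have d: "(\<phi> has_derivative \<phi>' \<tau>) (at \<tau> within {0..1})" for \<tau>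
    proof -
      have "((\<lambda>\<tau>. g (x + \<tau> *\<^sub>R h)) has_derivative (\<lambda>v. Dg (x + \<tau> *\<^sub>R h) (v *\<^sub>R h))) (at \<tau> within {0..1})"
        by (rule has_derivative_compose[OF _ g1]) (auto intro!: derivative_eq_intros)
      then show ?thesis unfolding \<phi>_def \<phi>'_def
        by (auto intro!: derivative_eq_intros simp: blinfun.bilinear_simps algebra_simps)
    qed
    have b: "onorm (\<phi>' \<tau>) \<le> e * (norm h)\<^sup>2" if "\<tau> \<in> {0..1}" for \<tau>
    proof (rule onorm_le)
      fix v :: real
      have th: "norm (\<tau> *\<^sub>R h) \<le> norm h" using that by (simp add: mult_left_le_one_le)
      have "norm ((Dg (x + \<tau> *\<^sub>R h) - Dg x - D2 (\<tau> *\<^sub>R h)) h)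
          \<le> norm (Dg (x + \<tau> *\<^sub>R h) - Dg x - D2 (\<tau> *\<^sub>R h)) * norm h" by (rule norm_blinfun)
      also have "\<dots> \<le> (e * norm (\<tau> *\<^sub>R h)) * norm h"
        using R[of "x + \<tau> *\<^sub>R h"] th h by (intro mult_right_mono) auto
      also have "\<dots> \<le> (e * norm h) * norm h" using th e by (intro mult_right_mono mult_left_mono) auto
      finally have "norm ((Dg (x + \<tau> *\<^sub>R h) - Dg x - D2 (\<tau> *\<^sub>R h)) h) \<le> e * (norm h)\<^sup>2"
        by (simp add: power2_eq_square)
      then have "\<bar>v\<bar> * norm ((Dg (x + \<tau> *\<^sub>R h) - Dg x - D2 (\<tau> *\<^sub>R h)) h) \<le> \<bar>v\<bar> * (e * (norm h)\<^sup>2)"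
        by (rule mult_left_mono) simp
      then show "norm (\<phi>' \<tau> v) \<le> e * (norm h)\<^sup>2 * norm v"
        by (simp add: \<phi>'_def mult.commute)
    qed
    have "norm (\<phi> 1 - \<phi> 0) \<le> e * (norm h)\<^sup>2 * norm (1 - 0 :: real)"
      by (rule differentiable_bound[where S="{0..1}" and f'=\<phi>', OF _ d b]) auto
    moreover have "\<phi> 1 - \<phi> 0 = g (x + h) - g x - Dg x h - (1/2) *\<^sub>R D2 h h"
      by (simp add: \<phi>_def)
    ultimately show ?thesis by simp
  qed
  then show ?thesis using r by blast
qed

text \<open>The increment is \<open>t p\<close> with \<open>p\<close> tending to \<open>d\<close>,
  so its squared norm divided by \<open>2 s\<close> tends to \<open>\<gamma>\<close> times that of
  \<open>d\<close>. Division by \<open>s\<close> therefore kills the Taylor remainder and leaves the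
  weight \<open>\<gamma>\<close> on the quadratic term.\<close>

lemma second_order_expansion:
  fixes g :: "'a::real_normed_vector \<Rightarrow> 'b::real_normed_vector"
  assumes g1: "\<And>x. (g has_derivative blinfun_apply (Dg x)) (at x)"
    and g2: "(Dg has_derivative blinfun_apply D2) (at x)"
    and t: "\<And>k::nat. t k > 0" and s: "\<And>k. s k > 0" and t0: "t \<longlonglongrightarrow> 0"
    and st: "(\<lambda>k. s k / t k) \<longlonglongrightarrow> 0"
    and ts: "(\<lambda>k. (t k)\<^sup>2 / (2 * s k)) \<longlonglongrightarrow> \<gamma>" and ww: "ww \<longlonglongrightarrow> w"
  shows "(\<lambda>k. (1 / s k) *\<^sub>R (g (x + t k *\<^sub>R d + s k *\<^sub>R ww k) - g x - t k *\<^sub>R Dg x d))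
     \<longlonglongrightarrow> Dg x w + \<gamma> *\<^sub>R D2 d d"
proof -
  define h where "h k = t k *\<^sub>R d + s k *\<^sub>R ww k" for k
  define p where "p k = d + (s k / t k) *\<^sub>R ww k" for k
  define R where "R k = g (x + h k) - g x - Dg x (h k) - (1/2) *\<^sub>R D2 (h k) (h k)" for k
  have hp: "h k = t k *\<^sub>R p k" for k using t[of k] by (simp add: h_def p_def algebra_simps)
  have "p \<longlonglongrightarrow> d + 0 *\<^sub>R w" unfolding p_def by (intro tendsto_intros st ww)
  then have p: "p \<longlonglongrightarrow> d" by simp
  have "h \<longlonglongrightarrow> 0 *\<^sub>R d" unfolding hp by (intro tendsto_intros t0 p)
  then have h0: "h \<longlonglongrightarrow> 0" by simp
  \<comment> \<open>Where \<open>h k = 0\<close> the quotient is 0 by the convention for division,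
    and \<open>R k\<close> vanishes too, so \<open>Rn\<close> below holds there as well.\<close>
  define \<psi> where "\<psi> k = norm (R k) / (norm (h k))\<^sup>2" for k
  have \<psi>: "\<psi> \<longlonglongrightarrow> 0"
  proof (rule LIMSEQ_I)
    fix e :: real assume "e > 0"
    then obtain r where r: "r > 0" "\<And>h. norm h < r \<Longrightarrow>
        norm (g (x + h) - g x - Dg x h - (1/2) *\<^sub>R D2 h h) \<le> e/2 * (norm h)\<^sup>2"
      using second_order_taylor[OF g1 g2, of "e/2"] by auto
    from LIMSEQ_D[OF h0 r(1)] obtain N where N: "\<And>k. k \<ge> N \<Longrightarrow> norm (h k) < r" by auto
    have "norm (\<psi> k - 0) < e" if "k \<ge> N" for k
    proof (cases "h k = 0")
      case True then show ?thesis using \<open>e > 0\<close> by (simp add: \<psi>_def)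
    next
      case False
      then have "\<psi> k \<le> e/2" using r(2)[OF N[OF that]] by (simp add: \<psi>_def R_def field_simps)
      moreover have "\<psi> k \<ge> 0" by (simp add: \<psi>_def)
      ultimately show ?thesis using \<open>e > 0\<close> by simp
    qed
    then show "\<exists>N. \<forall>k\<ge>N. norm (\<psi> k - 0) < e" by blast
  qed
  have Rn: "norm (R k) = \<psi> k * (norm (h k))\<^sup>2" for k
    by (cases "h k = 0") (simp_all add: \<psi>_def R_def)
  have "(\<lambda>k. \<psi> k * (norm (p k))\<^sup>2 * (2 * ((t k)\<^sup>2 / (2 * s k)))) \<longlonglongrightarrow> 0 * (norm d)\<^sup>2 * (2 * \<gamma>)"
    by (intro tendsto_intros \<psi> p ts)
  moreover have "norm ((1 / s k) *\<^sub>R R k) = \<psi> k * (norm (p k))\<^sup>2 * (2 * ((t k)\<^sup>2 / (2 * s k)))" for k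
    using s[of k] t[of k] by (simp add: Rn hp power_mult_distrib)
  ultimately have "(\<lambda>k. norm ((1 / s k) *\<^sub>R R k)) \<longlonglongrightarrow> 0" by (simp only: mult_zero_left)
  then have R0: "(\<lambda>k. (1 / s k) *\<^sub>R R k) \<longlonglongrightarrow> 0" by (rule tendsto_norm_zero_cancel)
  have "(\<lambda>k. Dg x (ww k) + ((t k)\<^sup>2 / (2 * s k)) *\<^sub>R D2 (p k) (p k) + (1 / s k) *\<^sub>R R k)
      \<longlonglongrightarrow> Dg x w + \<gamma> *\<^sub>R D2 d d + 0"
    by (intro tendsto_intros ww ts p R0)
  moreover have "Dg x (ww k) + ((t k)\<^sup>2 / (2 * s k)) *\<^sub>R D2 (p k) (p k) + (1 / s k) *\<^sub>R R k
      = (1 / s k) *\<^sub>R (g (x + t k *\<^sub>R d + s k *\<^sub>R ww k) - g x - t k *\<^sub>R Dg x d)" for k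
  proof -
    have "Dg x (h k) = t k *\<^sub>R Dg x d + s k *\<^sub>R Dg x (ww k)"
      by (simp add: h_def blinfun.bilinear_simps)
    moreover have "D2 (h k) (h k) = (t k)\<^sup>2 *\<^sub>R D2 (p k) (p k)"
      by (simp add: hp blinfun.bilinear_simps power2_eq_square)
    moreover have xh: "x + t k *\<^sub>R d + s k *\<^sub>R ww k = x + h k" by (simp add: h_def)
    ultimately show ?thesis unfolding xh using s[of k]
      by (simp add: R_def scaleR_diff_right scaleR_add_right mult.commute)
  qed
  ultimately show ?thesis by (simp only: add_0_right)
qed

section \<open>Normals\<close>

lemma zero_in_proximal_normal: "x \<in> A \<Longrightarrow> 0 \<in> proximal_normal A x"
  unfolding proximal_normal_def by (auto intro: exI[of _ 1])

lemma proximal_normal_scaleR: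
  assumes "v \<in> proximal_normal A x" "c \<ge> 0"
  shows "c *\<^sub>R v \<in> proximal_normal A x"
proof (cases "c = 0")
  case True
  then show ?thesis using assms zero_in_proximal_normal[of x A] by (auto simp: proximal_normal_def)
next
  case False
  then have c: "c > 0" using assms by simp
  obtain \<tau> where \<tau>: "x \<in> A" "\<tau> > 0" "\<forall>a\<in>A. dist (x + \<tau> *\<^sub>R v) x \<le> dist (x + \<tau> *\<^sub>R v) a"
    using assms unfolding proximal_normal_def by blast
  have "(\<tau> / c) *\<^sub>R c *\<^sub>R v = \<tau> *\<^sub>R v" using c by simp
  then show ?thesis unfolding proximal_normal_def using \<tau> c
    by (intro CollectI conjI exI[of _ "\<tau> / c"]) auto
qed

text \<open>Squaring the nearest-point inequality and cancelling the common term gives the bound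
  with \<open>\<sigma> = 1/(2 \<tau>)\<close>.\<close>

lemma proximal_normal_inner_le:
  assumes "v \<in> proximal_normal A x"
  obtains \<sigma> where "\<sigma> > 0" "\<And>y. y \<in> A \<Longrightarrow> inner v (y - x) \<le> \<sigma> * (norm (y - x))\<^sup>2"
proof -
  obtain \<tau> where \<tau>: "\<tau> > 0" "\<forall>a\<in>A. dist (x + \<tau> *\<^sub>R v) x \<le> dist (x + \<tau> *\<^sub>R v) a"
    using assms unfolding proximal_normal_def by blast
  have "inner v (y - x) \<le> (1 / (2 * \<tau>)) * (norm (y - x))\<^sup>2" if "y \<in> A" for y
  proof -
    have "norm (\<tau> *\<^sub>R v) \<le> norm (\<tau> *\<^sub>R v - (y - x))"
      using \<tau>(2) that by (force simp: dist_norm algebra_simps)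
    then have "(norm (\<tau> *\<^sub>R v))\<^sup>2 \<le> (norm (\<tau> *\<^sub>R v - (y - x)))\<^sup>2" by (simp add: power_mono)
    also have "\<dots> = (norm (\<tau> *\<^sub>R v))\<^sup>2 - 2 * \<tau> * inner v (y - x) + (norm (y - x))\<^sup>2"
      unfolding power2_norm_eq_inner
      by (simp add: inner_diff_left inner_diff_right inner_commute algebra_simps)
    finally show ?thesis using \<tau>(1) by (simp add: field_simps)
  qed
  then show ?thesis using that[of "1 / (2 * \<tau>)"] \<tau>(1) by simp
qed

lemma proximal_normal_subset_frechet_normal: "proximal_normal A x \<subseteq> frechet_normal A x"
proof
  fix v assume v: "v \<in> proximal_normal A x"
  then obtain \<sigma> where \<sigma>: "\<sigma> > 0" "\<And>y. y \<in> A \<Longrightarrow> inner v (y - x) \<le> \<sigma> * (norm (y - x))\<^sup>2"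
    by (rule proximal_normal_inner_le) blast
  have "inner v (y - x) \<le> e * norm (y - x)" if "y \<in> A" "norm (y - x) < e / \<sigma>" for e y
  proof -
    have "\<sigma> * norm (y - x) \<le> e" using that(2) \<sigma>(1) by (simp add: field_simps)
    then have "\<sigma> * norm (y - x) * norm (y - x) \<le> e * norm (y - x)" by (intro mult_right_mono) auto
    then show ?thesis using \<sigma>(2)[OF that(1)] by (simp add: power2_eq_square)
  qed
  moreover have "x \<in> A" using v by (simp add: proximal_normal_def)
  ultimately show "v \<in> frechet_normal A x"
    unfolding frechet_normal_def using \<sigma>(1)
    by (auto intro!: exI[of _ "_ / \<sigma>"])
qed

lemma proximal_normal_nearest:
  assumes "u \<in> A" "infdist q A = dist q u"
  shows "q - u \<in> proximal_normal A u"
proof -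
  have "dist q u \<le> dist q a" if "a \<in> A" for a using infdist_le[OF that, of q] assms(2) by simp
  then show ?thesis unfolding proximal_normal_def using assms(1)
    by (auto intro!: exI[of _ 1])
qed

text \<open>A positive homothety scales all distances by \<open>s\<close>, so nearest points
  correspond, with proximal step \<open>s * \<tau>\<close> in place of \<open>\<tau>\<close> and the
  same normal vector.\<close>

lemma proximal_normal_affine:
  assumes s: "s > 0" and v: "v \<in> proximal_normal {z. b + s *\<^sub>R z \<in> A} z"
  shows "v \<in> proximal_normal A (b + s *\<^sub>R z)"
proof -
  obtain \<tau> where \<tau>: "b + s *\<^sub>R z \<in> A" "\<tau> > 0"
    "\<And>a. b + s *\<^sub>R a \<in> A \<Longrightarrow> dist (z + \<tau> *\<^sub>R v) z \<le> dist (z + \<tau> *\<^sub>R v) a"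
    using v unfolding proximal_normal_def by blast
  have "dist (b + s *\<^sub>R z + (s * \<tau>) *\<^sub>R v) (b + s *\<^sub>R z) \<le> dist (b + s *\<^sub>R z + (s * \<tau>) *\<^sub>R v) a" if "a \<in> A" for a
  proof -
    define a' where "a' = (1 / s) *\<^sub>R (a - b)"
    have a: "a = b + s *\<^sub>R a'" using s by (simp add: a'_def)
    have "b + s *\<^sub>R z + (s * \<tau>) *\<^sub>R v - (b + s *\<^sub>R z) = s *\<^sub>R (z + \<tau> *\<^sub>R v - z)"
      "b + s *\<^sub>R z + (s * \<tau>) *\<^sub>R v - a = s *\<^sub>R (z + \<tau> *\<^sub>R v - a')"
      unfolding a by (simp_all add: algebra_simps)
    then show ?thesis using \<tau>(3)[of a'] that a s unfolding dist_norm by (simp only: norm_scaleR) simp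
  qed
  then show ?thesis unfolding proximal_normal_def using \<tau> s
    by (intro CollectI conjI exI[of _ "s * \<tau>"]) auto
qed

section \<open>Directional limiting normals\<close>

text \<open>A form without sequences, so that closedness below follows by halving \<open>e\<close>
  instead of a diagonal argument.\<close>

lemma dir_normal_iff_approx:
  "v \<in> dir_normal A x d \<longleftrightarrow> (\<forall>e>0. \<exists>t d' v'. 0 < t \<and> t < e \<and> dist d' d < e \<and> dist v' v < e \<and>
      v' \<in> frechet_normal A (x + t *\<^sub>R d'))" (is "_ \<longleftrightarrow> ?R")
proof
  assume "v \<in> dir_normal A x d"
  then obtain t dd vs where *: "\<And>k. t k > (0::real)" "t \<longlonglongrightarrow> 0" "dd \<longlonglongrightarrow> d" "vs \<longlonglongrightarrow> v"
      "\<And>k. vs k \<in> frechet_normal A (x + t k *\<^sub>R dd k)"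
    unfolding dir_normal_def by blast
  show ?R
  proof (intro allI impI)
    fix e :: real assume e: "e > 0"
    have "\<forall>\<^sub>F k in sequentially. t k < e \<and> dist (dd k) d < e \<and> dist (vs k) v < e"
      using e by (intro eventually_conj order_tendstoD(2)[OF *(2)] tendstoD[OF *(3)] tendstoD[OF *(4)])
    then obtain k where "t k < e \<and> dist (dd k) d < e \<and> dist (vs k) v < e"
      using eventually_happens'[OF sequentially_bot] by blast
    then show "\<exists>t d' v'. 0 < t \<and> t < e \<and> dist d' d < e \<and> dist v' v < e \<and>
      v' \<in> frechet_normal A (x + t *\<^sub>R d')" using * by blast
  qed
next
  let ?e = "\<lambda>k::nat. inverse (real (Suc k))"
  assume ?R
  then have "\<forall>k. \<exists>t d' v'. 0 < t \<and> t < ?e k \<and> dist d' d < ?e k \<and> dist v' v < ?e k \<and>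
      v' \<in> frechet_normal A (x + t *\<^sub>R d')" by auto
  then obtain t dd vs where *: "\<And>k. 0 < t k \<and> t k < ?e k \<and> dist (dd k) d < ?e k \<and> dist (vs k) v < ?e k \<and>
      vs k \<in> frechet_normal A (x + t k *\<^sub>R dd k)" by metis
  have e: "?e \<longlonglongrightarrow> 0" by (rule LIMSEQ_inverse_real_of_nat)
  have "t \<longlonglongrightarrow> 0"
    by (rule Lim_null_comparison[OF always_eventually e]) (use * in \<open>auto simp: less_imp_le abs_of_pos\<close>)
  moreover have "dd \<longlonglongrightarrow> d" "vs \<longlonglongrightarrow> v"
    by (rule LIM_zero_cancel, rule Lim_null_comparison[OF always_eventually e],
        use * in \<open>auto simp: less_imp_le dist_norm\<close>)+
  ultimately show "v \<in> dir_normal A x d" unfolding dir_normal_def using * by blast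
qed

text \<open>Lets limits of multipliers stay directional normals: the multipliers are first found as
  proximal normals and then pass through two limits, in the penalty and in the
  regularisation.\<close>

lemma closed_dir_normal: "closed (dir_normal A x d)"
proof -
  have "v \<in> dir_normal A x d" if "v \<in> closure (dir_normal A x d)" for v
    unfolding dir_normal_iff_approx
  proof (intro allI impI)
    fix e :: real assume e: "e > 0"
    obtain u where u: "u \<in> dir_normal A x d" "dist u v < e/2"
      using \<open>v \<in> closure _\<close> e unfolding closure_approachable by (meson half_gt_zero)
    from u(1) half_gt_zero[OF e] obtain t d' v' where "0 < t" "t < e/2" "dist d' d < e/2"
      "dist v' u < e/2" "v' \<in> frechet_normal A (x + t *\<^sub>R d')"
      unfolding dir_normal_iff_approx by blast
    moreover have "dist v' v < e" using dist_triangle[of v' v u] u(2) calculation by linarith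
    ultimately show "\<exists>t d' v'. 0 < t \<and> t < e \<and> dist d' d < e \<and> dist v' v < e \<and>
      v' \<in> frechet_normal A (x + t *\<^sub>R d')"
      using e by (intro exI[of _ t] exI[of _ d'] exI[of _ v']) auto
  qed
  then show ?thesis using closure_subset_eq by blast
qed

lemma frechet_normal_scaleR:
  assumes v: "v \<in> frechet_normal A x" and c: "c > 0"
  shows "c *\<^sub>R v \<in> frechet_normal A x"
  unfolding frechet_normal_def
proof (intro CollectI conjI allI impI)
  show "x \<in> A" using v by (simp add: frechet_normal_def)
  fix e :: real assume "e > 0"
  then have "e / c > 0" using c by simp
  then obtain r where r: "r > 0" "\<And>y. y \<in> A \<Longrightarrow> norm (y - x) < r \<Longrightarrow> inner v (y - x) \<le> e / c * norm (y - x)"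
    using v unfolding frechet_normal_def by blast
  have "inner (c *\<^sub>R v) (y - x) \<le> e * norm (y - x)" if "y \<in> A" "norm (y - x) < r" for y
    using r(2)[OF that] c by (simp add: field_simps)
  then show "\<exists>r>0. \<forall>y\<in>A. norm (y - x) < r \<longrightarrow> inner (c *\<^sub>R v) (y - x) \<le> e * norm (y - x)"
    using r(1) by blast
qed

lemma dir_normal_scaleR:
  assumes "v \<in> dir_normal A x d" "c > 0"
  shows "c *\<^sub>R v \<in> dir_normal A x d"
proof -
  obtain t dd vs where *: "\<And>k. t k > (0::real)" "t \<longlonglongrightarrow> 0" "dd \<longlonglongrightarrow> d" "vs \<longlonglongrightarrow> v"
      "\<And>k. vs k \<in> frechet_normal A (x + t k *\<^sub>R dd k)"
    using assms unfolding dir_normal_def by blast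
  have "(\<lambda>k. c *\<^sub>R vs k) \<longlonglongrightarrow> c *\<^sub>R v" by (intro tendsto_intros *)
  then show ?thesis unfolding dir_normal_def using * assms(2) frechet_normal_scaleR by blast
qed

text \<open>Halving the step makes the base point the unique nearest point, so projections onto the
  blown-up sets \<open>(K - y - t v) / s\<close> converge to it.\<close>

lemma proximal_normal_scaled_tangent_subset:
  fixes K :: "'b::euclidean_space set"
  assumes K: "closed K" and p: "p \<in> proximal_normal (scaled_tangent \<gamma> K y v) u"
  shows "p \<in> dir_normal K y v"
proof -
  let ?D = "scaled_tangent \<gamma> K y v"
  obtain \<tau> where uD: "u \<in> ?D" and \<tau>: "\<tau> > 0"
    and near: "\<And>a. a \<in> ?D \<Longrightarrow> dist (u + \<tau> *\<^sub>R p) u \<le> dist (u + \<tau> *\<^sub>R p) a"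
    using p unfolding proximal_normal_def by blast
  \<comment> \<open>Half of the proximal step \<open>\<tau> *\<^sub>R p\<close>, as needed for
    uniqueness of the nearest point.\<close>
  define h where "h = (\<tau> / 2) *\<^sub>R p"
  define q where "q = u + h"
  obtain t s uu where *: "\<And>k::nat. t k > 0" "\<And>k. s k > 0" "t \<longlonglongrightarrow> 0"
    "(\<lambda>k. s k / t k) \<longlonglongrightarrow> 0" "(\<lambda>k. (t k)\<^sup>2 / (2 * s k)) \<longlonglongrightarrow> \<gamma>" "uu \<longlonglongrightarrow> u"
    "\<And>k. y + t k *\<^sub>R v + s k *\<^sub>R uu k \<in> K" using scaled_tangentE[OF uD] by blast
  define E where "E k = {z. (y + t k *\<^sub>R v) + s k *\<^sub>R z \<in> K}" for k
  have cE: "closed (E k)" for k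
  proof -
    have "continuous_on UNIV (\<lambda>z. (y + t k *\<^sub>R v) + s k *\<^sub>R z)" by (intro continuous_intros)
    from closed_vimage[OF K this] show ?thesis by (simp add: E_def vimage_def)
  qed
  have uuE: "uu k \<in> E k" for k using * by (simp add: E_def)
  have "\<exists>z. z \<in> E k \<and> infdist q (E k) = dist q z" for k
    using infdist_attains_inf[OF cE[of k], of q] uuE[of k] by blast
  then obtain z where z: "\<And>k. z k \<in> E k" "\<And>k. infdist q (E k) = dist q (z k)" by metis
  have zle: "dist q (z k) \<le> dist q (uu k)" for k using infdist_le[OF uuE, of q k] z(2)[of k] by simp
  have "bounded (range uu)" using *(6) convergent_imp_bounded by blast
  then obtain M where M: "\<And>k. norm (uu k) \<le> M" unfolding bounded_iff by blast
  \<comment> \<open>The projections are no farther from \<open>q\<close> than the convergent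
    sequence \<open>uu\<close>, hence bounded, and a cluster point \<open>w\<close> exists; it lies
    in the tangent set because it comes from the same scales.\<close>
  have zb: "z k \<in> cball q (norm q + M)" for k
    using zle[of k] M[of k] norm_triangle_ineq4[of q "uu k"] by (simp add: dist_norm)
  obtain w r where r: "strict_mono (r::nat\<Rightarrow>nat)" "(z \<circ> r) \<longlonglongrightarrow> w"
    using compact_cball[of q "norm q + M"] zb unfolding compact_def by metis
  have wD: "w \<in> ?D"
  proof (rule scaled_tangentI[of "t \<circ> r" "s \<circ> r" _ "z \<circ> r"])
    show "(t \<circ> r) \<longlonglongrightarrow> 0" by (rule LIMSEQ_subseq_LIMSEQ[OF *(3) r(1)])
    show "(\<lambda>k. (s \<circ> r) k / (t \<circ> r) k) \<longlonglongrightarrow> 0"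
      using LIMSEQ_subseq_LIMSEQ[OF *(4) r(1)] by (simp add: o_def)
    show "(\<lambda>k. ((t \<circ> r) k)\<^sup>2 / (2 * (s \<circ> r) k)) \<longlonglongrightarrow> \<gamma>"
      using LIMSEQ_subseq_LIMSEQ[OF *(5) r(1)] by (simp add: o_def)
  qed (use * r z(1) in \<open>auto simp: E_def\<close>)
  have "dist q w \<le> dist q u"
    by (rule LIMSEQ_le[OF tendsto_dist[OF tendsto_const r(2)]
          tendsto_dist[OF tendsto_const LIMSEQ_subseq_LIMSEQ[OF *(6) r(1)]]]) (use zle in auto)
  \<comment> \<open>With \<open>z = w - u\<close>, this inequality says that the squared norm of
    \<open>z\<close> is at most \<open>2 inner h z\<close>, and the next one that
    \<open>4 inner h z\<close> is at most the squared norm of \<open>z\<close>; together they force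
    \<open>z = 0\<close>.\<close>
  then have "(norm (h - (w - u)))\<^sup>2 \<le> (norm h)\<^sup>2"
    by (simp add: q_def dist_norm power_mono algebra_simps)
  moreover have "(norm (2 *\<^sub>R h))\<^sup>2 \<le> (norm (2 *\<^sub>R h - (w - u)))\<^sup>2"
    using near[OF wD] by (intro power_mono) (simp_all add: h_def dist_norm algebra_simps)
  ultimately have "(norm (w - u))\<^sup>2 \<le> 0"
    unfolding power2_norm_eq_inner
    by (simp add: inner_diff_left inner_diff_right inner_commute algebra_simps)
  then have wu: "w = u" by simp
  have "q - u \<in> dir_normal K y v"
    unfolding dir_normal_def
  proof (intro CollectI exI conjI allI)
    show "(t \<circ> r) k > 0" for k using * by simp
    show "(t \<circ> r) \<longlonglongrightarrow> 0" by (rule LIMSEQ_subseq_LIMSEQ[OF *(3) r(1)])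
    \<comment> \<open>The foot point in \<open>K\<close> is
      \<open>y + t v + s z = y + t (v + (s/t) z)\<close>; since \<open>s/t\<close> tends to 0, it
      approaches \<open>y\<close> in direction \<open>v\<close>.\<close>
    have "(\<lambda>k. v + ((\<lambda>k. s k / t k) \<circ> r) k *\<^sub>R (z \<circ> r) k) \<longlonglongrightarrow> v + 0 *\<^sub>R w"
      by (intro tendsto_intros r LIMSEQ_subseq_LIMSEQ[OF *(4)])
    then show "(\<lambda>k. v + (s (r k) / t (r k)) *\<^sub>R z (r k)) \<longlonglongrightarrow> v" by simp
    show "(\<lambda>k. q - (z \<circ> r) k) \<longlonglongrightarrow> q - u" using wu by (intro tendsto_intros) (use r in \<open>simp add: o_def\<close>)
    show "q - (z \<circ> r) k \<in> frechet_normal K (y + (t \<circ> r) k *\<^sub>R (v + (s (r k) / t (r k)) *\<^sub>R z (r k)))" for k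
    proof -
      have "q - z (r k) \<in> proximal_normal {z. (y + t (r k) *\<^sub>R v) + s (r k) *\<^sub>R z \<in> K} (z (r k))"
        using proximal_normal_nearest[OF z(1,2)] by (simp add: E_def)
      from proximal_normal_affine[OF *(2) this]
      have "q - z (r k) \<in> frechet_normal K (y + t (r k) *\<^sub>R v + s (r k) *\<^sub>R z (r k))"
        using proximal_normal_subset_frechet_normal by blast
      then show ?thesis using *(1)[of "r k"] by (simp add: algebra_simps)
    qed
  qed
  from dir_normal_scaleR[OF this, of "2 / \<tau>"] show ?thesis using \<tau> by (simp add: q_def h_def)
qed

section \<open>Multipliers for linear programs over a closed set\<close>

text \<open>Fermat's rule in a form that avoids differentiating a squared distance: a quadratic
  majorant that touches at the minimiser suffices.\<close>

lemma affine_quadratic_nonneg_zero: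
  fixes p q :: real
  assumes "\<And>\<tau>. 0 \<le> \<tau> * p + \<tau>\<^sup>2 * q"
  shows "p = 0"
proof (rule ccontr)
  assume p: "p \<noteq> 0"
  \<comment> \<open>Small enough that at \<open>\<tau> = - c p\<close> the linear term outweighs the
    quadratic one.\<close>
  define c where "c = 1 / (2 * (\<bar>q\<bar> + 1))"
  have c: "c > 0" "c * \<bar>q\<bar> \<le> 1/2" by (simp_all add: c_def field_simps)
  have "0 \<le> (- c * p) * p + (- c * p)\<^sup>2 * q" by (rule assms)
  also have "\<dots> = c * p\<^sup>2 * (c * q - 1)" by (simp add: power2_eq_square algebra_simps)
  finally have "0 \<le> c * p\<^sup>2 * (c * q - 1)" .
  moreover have "c * p\<^sup>2 > 0" using c(1) p by simp
  ultimately have "0 \<le> c * q - 1" using zero_le_mult_iff by (metis linorder_not_less)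
  moreover have "c * q \<le> c * \<bar>q\<bar>" using c(1) by simp
  ultimately show False using c(2) by linarith
qed

text \<open>The quadratic term makes the penalised problems coercive; the error bound keeps their
  multipliers \<open>n (a + G w - u)\<close> bounded as the penalty parameter \<open>n\<close> grows.\<close>

lemma regularized_multiplier:
  fixes G :: "'a::euclidean_space \<Rightarrow>\<^sub>L 'b::euclidean_space" and c :: "'a \<Rightarrow>\<^sub>L real"
  assumes D: "closed D" and w0: "a + G w0 \<in> D"
    and err: "\<And>w. \<exists>w'. a + G w' \<in> D \<and> norm (w' - w) \<le> \<kappa>0 * infdist (a + G w) D"
    and \<kappa>0: "\<kappa>0 > 0" and e: "e > 0"
    and N: "closed N" and NN: "\<And>u. proximal_normal D u \<subseteq> N"
  shows "\<exists>w l. a + G w \<in> D \<and> l \<in> limiting_normal D (a + G w) \<and> l \<in> N \<and>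
     norm l \<le> 2 * \<kappa>0 * (norm c + e * norm w) \<and>
     (\<forall>v. c v + e * inner w v + inner l (G v) = 0) \<and>
     c w + e / 2 * (norm w)\<^sup>2 \<le> c w0 + e / 2 * (norm w0)\<^sup>2"
proof -
  define \<phi> where "\<phi> w = c w + e / 2 * (norm w)\<^sup>2" for w
  \<comment> \<open>Outside this ball the quadratic term beats the linear one by more than the
    absolute value of \<open>\<phi> w0\<close>; the summand 1 gives \<open>norm w > 1\<close>, which
    allows multiplication by \<open>norm w\<close>.\<close>
  define R where "R = 1 + 2 * (norm c + \<bar>\<phi> w0\<bar>) / e"
  have c_le: "\<bar>c v\<bar> \<le> norm c * norm v" for v using norm_blinfun[of c v] by simp
  have big: "\<phi> w > \<phi> w0" if "norm w > R" for w
  proof -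
    have "norm w > 1" using that e unfolding R_def by (smt (verit) abs_ge_zero divide_nonneg_pos mult_nonneg_nonneg norm_ge_zero)
    have "2 * (norm c + \<bar>\<phi> w0\<bar>) / e < norm w" using that unfolding R_def by simp
    then have "norm c + \<bar>\<phi> w0\<bar> < e / 2 * norm w" using e by (simp add: field_simps)
    then have "(e / 2 * norm w - norm c) * norm w > \<bar>\<phi> w0\<bar> * 1"
      using \<open>norm w > 1\<close> by (intro mult_strict_mono') auto
    moreover have "\<phi> w \<ge> (e / 2 * norm w - norm c) * norm w"
      using c_le[of w] by (simp add: \<phi>_def power2_eq_square algebra_simps abs_le_iff)
    ultimately show ?thesis by linarith
  qed
  have w0R: "norm w0 \<le> R" using big[of w0] by force
  define \<psi> where "\<psi> n w = \<phi> w + real (Suc n) / 2 * (infdist (a + G w) D)\<^sup>2" for n w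
  have \<psi>0: "\<psi> n w0 = \<phi> w0" for n using w0 by (simp add: \<psi>_def)
  have \<phi>\<psi>: "\<phi> w \<le> \<psi> n w" for n w by (simp add: \<psi>_def)
  have "\<exists>w. norm w \<le> R \<and> (\<forall>w'. \<psi> n w \<le> \<psi> n w')" for n
  proof -
    have "continuous_on (cball 0 R) (\<psi> n)"
      unfolding \<psi>_def \<phi>_def by (intro continuous_intros)
    moreover have "cball (0::'a) R \<noteq> {}" using w0R norm_ge_zero[of w0] by (auto simp del: norm_ge_zero)
    ultimately obtain w where w: "w \<in> cball 0 R" "\<forall>w'\<in>cball 0 R. \<psi> n w \<le> \<psi> n w'"
      using continuous_attains_inf[OF compact_cball] by blast
    have "\<psi> n w \<le> \<psi> n w'" for w'
    proof (cases "norm w' \<le> R")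
      case False
      have "\<psi> n w \<le> \<psi> n w0" using w w0R by simp
      also have "\<dots> \<le> \<psi> n w'" using big[of w'] False \<phi>\<psi>[of w' n] \<psi>0[of n] by simp
      finally show ?thesis .
    qed (use w in simp)
    then show ?thesis using w by auto
  qed
  then obtain W where W: "\<And>n. norm (W n) \<le> R" "\<And>n w'. \<psi> n (W n) \<le> \<psi> n w'" by metis
  have "\<exists>u. u \<in> D \<and> infdist (a + G (W n)) D = dist (a + G (W n)) u" for n
    using infdist_attains_inf[OF D, of "a + G (W n)"] w0 by blast
  then obtain u where u: "\<And>n. u n \<in> D" "\<And>n. infdist (a + G (W n)) D = dist (a + G (W n)) (u n)" by metis
  define l where "l n = real (Suc n) *\<^sub>R (a + G (W n) - u n)" for n
  define \<rho> where "\<rho> n = norm (a + G (W n) - u n)" for n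
  have inf\<rho>: "infdist (a + G (W n)) D = \<rho> n" for n using u(2) by (simp add: \<rho>_def dist_norm)
  have l_prox: "l n \<in> proximal_normal D (u n)" for n
    unfolding l_def by (intro proximal_normal_scaleR proximal_normal_nearest u) simp
  have stat: "c v + e * inner (W n) v + inner (l n) (G v) = 0" for n v
  proof (rule affine_quadratic_nonneg_zero)
    fix \<tau> :: real
    let ?b = "a + G (W n) - u n"
    \<comment> \<open>Freezing the nearest point \<open>u n\<close> majorises the squared distance
      by a quadratic in \<open>\<tau>\<close>, with equality at \<open>\<tau> = 0\<close>.\<close>
    have "infdist (a + G (W n + \<tau> *\<^sub>R v)) D \<le> norm (?b + \<tau> *\<^sub>R G v)"
      using infdist_le[OF u(1)[of n], of "a + G (W n + \<tau> *\<^sub>R v)"]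
      by (simp add: dist_norm blinfun.bilinear_simps algebra_simps)
    then have "(infdist (a + G (W n + \<tau> *\<^sub>R v)) D)\<^sup>2 \<le> (norm (?b + \<tau> *\<^sub>R G v))\<^sup>2"
      by (intro power_mono infdist_nonneg)
    then have "\<psi> n (W n + \<tau> *\<^sub>R v) \<le> \<phi> (W n + \<tau> *\<^sub>R v) + real (Suc n) / 2 * (norm (?b + \<tau> *\<^sub>R G v))\<^sup>2"
      unfolding \<psi>_def by (intro add_left_mono mult_left_mono) auto
    moreover have "\<psi> n (W n) = \<phi> (W n) + real (Suc n) / 2 * (norm ?b)\<^sup>2"
      by (simp add: \<psi>_def inf\<rho> \<rho>_def)
    ultimately have "0 \<le> (\<phi> (W n + \<tau> *\<^sub>R v) - \<phi> (W n)) +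
        real (Suc n) / 2 * ((norm (?b + \<tau> *\<^sub>R G v))\<^sup>2 - (norm ?b)\<^sup>2)"
      using W(2)[of n "W n + \<tau> *\<^sub>R v"] by (simp add: right_diff_distrib del: of_nat_Suc)
    also have "(norm (?b + \<tau> *\<^sub>R G v))\<^sup>2 - (norm ?b)\<^sup>2 = 2 * \<tau> * inner ?b (G v) + \<tau>\<^sup>2 * (norm (G v))\<^sup>2"
      unfolding power2_norm_eq_inner by (simp add: inner_add_left inner_add_right inner_commute power2_eq_square)
    also have "\<phi> (W n + \<tau> *\<^sub>R v) - \<phi> (W n) = \<tau> * c v + e / 2 * (2 * \<tau> * inner (W n) v + \<tau>\<^sup>2 * (norm v)\<^sup>2)"
      unfolding \<phi>_def power2_norm_eq_inner
      by (simp add: inner_add_left inner_add_right inner_commute power2_eq_square blinfun.bilinear_simps algebra_simps)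
    finally show "0 \<le> \<tau> * (c v + e * inner (W n) v + inner (l n) (G v))
        + \<tau>\<^sup>2 * (e / 2 * (norm v)\<^sup>2 + real (Suc n) / 2 * (norm (G v))\<^sup>2)"
      by (simp add: l_def algebra_simps del: of_nat_Suc)
  qed
  have ln: "norm (l n) = real (Suc n) * \<rho> n" for n by (simp add: l_def \<rho>_def)
  have \<rho>0: "\<rho> n \<ge> 0" for n by (simp add: \<rho>_def)
  \<comment> \<open>Compare \<open>W n\<close> with a point \<open>w'\<close> of the constraint set
    given by the error bound. The penalty is at most \<open>\<phi> w' - \<phi> (W n)\<close>, which
    is of order \<open>\<kappa>0 * \<rho> n\<close>; dividing by \<open>\<rho> n\<close> bounds
    \<open>Suc n * \<rho> n\<close>, the norm of the multiplier.\<close>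
  have lb: "norm (l n) \<le> 2 * \<kappa>0 * (norm c + e * norm (W n) + e / 2 * \<kappa>0 * \<rho> n)" for n
  proof (cases "\<rho> n = 0")
    case True
    then show ?thesis using ln \<kappa>0 e by simp
  next
    case False
    then have \<rho>p: "\<rho> n > 0" using \<rho>0[of n] by simp
    obtain w' where w': "a + G w' \<in> D" "norm (w' - W n) \<le> \<kappa>0 * \<rho> n"
      using err[of "W n"] inf\<rho> by auto
    define \<beta> where "\<beta> = \<kappa>0 * \<rho> n"
    have \<beta>: "\<beta> > 0" using \<kappa>0 \<rho>p by (simp add: \<beta>_def)
    have "\<psi> n (W n) \<le> \<psi> n w'" by (rule W)
    then have 1: "real (Suc n) / 2 * (\<rho> n)\<^sup>2 \<le> \<phi> w' - \<phi> (W n)"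
      using w'(1) by (simp add: \<psi>_def inf\<rho> del: of_nat_Suc)
    have 2: "c w' - c (W n) \<le> norm c * \<beta>"
    proof -
      have "c w' - c (W n) = c (w' - W n)" by (simp add: blinfun.bilinear_simps)
      also have "\<dots> \<le> norm c * norm (w' - W n)" using c_le[of "w' - W n"] by simp
      also have "\<dots> \<le> norm c * \<beta>" unfolding \<beta>_def by (intro mult_left_mono w') auto
      finally show ?thesis .
    qed
    have "norm w' \<le> norm (W n) + \<beta>"
      using norm_triangle_ineq[of "W n" "w' - W n"] w'(2) by (simp add: \<beta>_def)
    then have "(norm w')\<^sup>2 \<le> (norm (W n) + \<beta>)\<^sup>2" by (simp add: power_mono)
    then have "(norm w')\<^sup>2 - (norm (W n))\<^sup>2 \<le> \<beta> * (2 * norm (W n) + \<beta>)"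
      by (simp add: power2_eq_square algebra_simps)
    then have "e / 2 * ((norm w')\<^sup>2 - (norm (W n))\<^sup>2) \<le> e / 2 * (\<beta> * (2 * norm (W n) + \<beta>))"
      using e by (intro mult_left_mono) auto
    then have "\<phi> w' - \<phi> (W n) \<le> norm c * \<beta> + e / 2 * (\<beta> * (2 * norm (W n) + \<beta>))"
      using 2 unfolding \<phi>_def by (simp add: algebra_simps)
    also have "\<dots> = \<rho> n * (\<kappa>0 * (norm c + e * norm (W n) + e / 2 * \<kappa>0 * \<rho> n))"
      by (simp add: \<beta>_def algebra_simps)
    finally have "\<rho> n * (real (Suc n) / 2 * \<rho> n) \<le> \<rho> n * (\<kappa>0 * (norm c + e * norm (W n) + e / 2 * \<kappa>0 * \<rho> n))"
      using 1 by (simp add: power2_eq_square algebra_simps del: of_nat_Suc)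
    then have "real (Suc n) / 2 * \<rho> n \<le> \<kappa>0 * (norm c + e * norm (W n) + e / 2 * \<kappa>0 * \<rho> n)"
      using \<rho>p mult_le_cancel_left_pos by blast
    then show ?thesis unfolding ln by linarith
  qed
  define M where "M = norm G * (R + R)"
  have \<rho>M: "\<rho> n \<le> M" for n
  proof -
    have "\<rho> n \<le> dist (a + G (W n)) (a + G w0)" using infdist_le[OF w0] inf\<rho> by metis
    also have "\<dots> = norm (G (W n - w0))" by (simp add: dist_norm blinfun.bilinear_simps)
    also have "\<dots> \<le> norm G * norm (W n - w0)" by (rule norm_blinfun)
    also have "\<dots> \<le> M" unfolding M_def
      using norm_triangle_ineq4[of "W n" w0] W(1)[of n] w0R by (intro mult_left_mono) auto
    finally show ?thesis .
  qed
  define L where "L = 2 * \<kappa>0 * (norm c + e * R + e / 2 * \<kappa>0 * M)"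
  have lL: "norm (l n) \<le> L" for n
  proof -
    have "norm c + e * norm (W n) + e / 2 * \<kappa>0 * \<rho> n \<le> norm c + e * R + e / 2 * \<kappa>0 * M"
      using W(1)[of n] \<rho>M[of n] e \<kappa>0 by (intro add_mono mult_left_mono) auto
    then show ?thesis using lb[of n] \<kappa>0 unfolding L_def
      by (smt (verit) mult_left_mono mult_nonneg_nonneg)
  qed
  \<comment> \<open>Bounded multipliers force the constraint violation down at rate
    \<open>1/(n+1)\<close>, so the base points \<open>u n\<close> and the points
    \<open>a + G (W n)\<close> have the same limits along subsequences.\<close>
  have "\<rho> n \<le> L * inverse (real (Suc n))" for n
    using lL[of n] ln[of n] by (simp add: field_simps)
  moreover have "(\<lambda>n. L * inverse (real (Suc n))) \<longlonglongrightarrow> L * 0"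
    by (intro tendsto_intros LIMSEQ_inverse_real_of_nat)
  ultimately have \<rho>lim: "\<rho> \<longlonglongrightarrow> 0"
    by (intro Lim_null_comparison[of \<rho> "\<lambda>n. L * inverse (real (Suc n))"] always_eventually) (use \<rho>0 in auto)
  have "\<forall>n. (W n, l n) \<in> cball 0 R \<times> cball 0 L" using W(1) lL by simp
  moreover have "seq_compact (cball (0::'a) R \<times> cball (0::'b) L)"
    unfolding compact_eq_seq_compact_metric[symmetric] by (intro compact_Times compact_cball)
  ultimately obtain P r where r: "strict_mono (r::nat\<Rightarrow>nat)" "((\<lambda>n. (W n, l n)) \<circ> r) \<longlonglongrightarrow> P"
    by (elim seq_compactE)
  define w where "w = fst P"
  define \<mu> where "\<mu> = snd P"
  have wl: "(\<lambda>n. W (r n)) \<longlonglongrightarrow> w" "(\<lambda>n. l (r n)) \<longlonglongrightarrow> \<mu>"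
    using tendsto_fst[OF r(2)] tendsto_snd[OF r(2)] by (simp_all add: o_def w_def \<mu>_def)
  have \<rho>r: "(\<lambda>n. \<rho> (r n)) \<longlonglongrightarrow> 0" using LIMSEQ_subseq_LIMSEQ[OF \<rho>lim r(1)] by (simp add: o_def)
  have "(\<lambda>n. a + G (W (r n)) - u (r n)) \<longlonglongrightarrow> 0"
    using \<rho>r unfolding \<rho>_def by (rule tendsto_norm_zero_cancel)
  then have "(\<lambda>n. a + G (W (r n)) - (a + G (W (r n)) - u (r n))) \<longlonglongrightarrow> a + G w - 0"
    by (intro tendsto_intros wl)
  then have ur: "(\<lambda>n. u (r n)) \<longlonglongrightarrow> a + G w" by simp
  have "a + G w \<in> D" by (rule closed_sequentially[OF D _ ur]) (use u in auto)
  moreover have "\<mu> \<in> limiting_normal D (a + G w)"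
    unfolding limiting_normal_def
    by (intro CollectI, rule exI[of _ "\<lambda>n. u (r n)"], rule exI[of _ "\<lambda>n. l (r n)"])
      (use ur wl u(1) subsetD[OF proximal_normal_subset_frechet_normal l_prox] in auto)
  moreover have "\<mu> \<in> N" by (rule closed_sequentially[OF N _ wl(2)]) (use l_prox NN in auto)
  moreover have "norm \<mu> \<le> 2 * \<kappa>0 * (norm c + e * norm w + e / 2 * \<kappa>0 * 0)"
  proof (rule LIMSEQ_le)
    show "(\<lambda>n. norm (l (r n))) \<longlonglongrightarrow> norm \<mu>" by (intro tendsto_intros wl)
    show "(\<lambda>n. 2 * \<kappa>0 * (norm c + e * norm (W (r n)) + e / 2 * \<kappa>0 * \<rho> (r n)))
        \<longlonglongrightarrow> 2 * \<kappa>0 * (norm c + e * norm w + e / 2 * \<kappa>0 * 0)"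
      by (intro tendsto_intros wl \<rho>r)
  qed (use lb in blast)
  moreover have "c v + e * inner w v + inner \<mu> (G v) = 0" for v
  proof (rule LIMSEQ_unique)
    show "(\<lambda>n. c v + e * inner (W (r n)) v + inner (l (r n)) (G v)) \<longlonglongrightarrow> c v + e * inner w v + inner \<mu> (G v)"
      by (intro tendsto_intros wl)
    show "(\<lambda>n. c v + e * inner (W (r n)) v + inner (l (r n)) (G v)) \<longlonglongrightarrow> 0" by (simp add: stat)
  qed
  moreover have "\<phi> w \<le> \<phi> w0"
  proof (rule LIMSEQ_le_const2)
    show "(\<lambda>n. \<phi> (W (r n))) \<longlonglongrightarrow> \<phi> w" unfolding \<phi>_def by (intro tendsto_intros wl)
    have "\<phi> (W n) \<le> \<phi> w0" for n using \<phi>\<psi>[of "W n" n] W(2)[of n w0] \<psi>0[of n] by simp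
    then show "\<exists>N. \<forall>n\<ge>N. \<phi> (W (r n)) \<le> \<phi> w0" by blast
  qed
  ultimately show ?thesis unfolding \<phi>_def by (intro exI[of _ w] exI[of _ \<mu>]) simp
qed

text \<open>For every radius the sequence \<open>ls\<close> eventually enters the ball, and there
  the pairs \<open>(ls n, us n)\<close> compete in both infima.\<close>

lemma lower_gen_support_le:
  fixes D :: "'a::real_inner set"
  assumes "D \<noteq> {}" "ls \<longlonglongrightarrow> l" "\<And>n. us n \<in> A" "\<And>n. ls n \<in> limiting_normal D (us n)"
    "\<And>n. inner (ls n) (us n) \<le> b n" "b \<longlonglongrightarrow> \<beta>"
  shows "lower_gen_support D A l \<le> ereal \<beta>"
proof -
  have "(INF l'\<in>ball l r. INF u\<in>{u\<in>A. l' \<in> limiting_normal D u}. ereal (inner l' u)) \<le> ereal \<beta>"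
    (is "?I \<le> _") if r: "r > 0" for r
  proof (rule tendsto_lowerbound)
    show "(\<lambda>n. ereal (b n)) \<longlonglongrightarrow> ereal \<beta>" using assms(6) by simp
    show "\<forall>\<^sub>F n in sequentially. ?I \<le> ereal (b n)"
      using tendstoD[OF assms(2) r]
    proof eventually_elim
      case (elim n)
      have "?I \<le> (INF u\<in>{u\<in>A. ls n \<in> limiting_normal D u}. ereal (inner (ls n) u))"
        by (rule INF_lower) (use elim in \<open>simp add: dist_commute\<close>)
      also have "\<dots> \<le> ereal (inner (ls n) (us n))" by (rule INF_lower) (use assms in simp)
      also have "\<dots> \<le> ereal (b n)" using assms(5) by simp
      finally show ?case .
    qed
  qed simp
  then show ?thesis unfolding lower_gen_support_def using assms(1) by (auto intro!: SUP_least)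
qed

text \<open>The infimum of \<open>c\<close> need not be attained and the regularised minimisers may
  escape to infinity, so the limit \<open>l\<close> need not be normal at any point; the liminf in
  the generalized support accommodates this. One \<open>l\<close> serves every \<open>B\<close>,
  since all approximating points lie in the image set that \<open>B\<close> contains.\<close>

lemma linear_program_multiplier:
  fixes G :: "'a::euclidean_space \<Rightarrow>\<^sub>L 'b::euclidean_space" and c :: "'a \<Rightarrow>\<^sub>L real"
  assumes D: "closed D" "D \<noteq> {}"
    and err: "\<And>w. \<exists>w'. a + G w' \<in> D \<and> norm (w' - w) \<le> \<kappa>0 * infdist (a + G w) D"
    and \<kappa>0: "\<kappa>0 > 0"
    and N: "closed N" "\<And>u. proximal_normal D u \<subseteq> N"
    and m: "\<And>w. a + G w \<in> D \<Longrightarrow> m \<le> c w"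
  shows "\<exists>l\<in>N. (\<forall>v. c v + inner (G v) l = 0) \<and>
    (\<forall>B. (\<forall>w. a + G w \<in> D \<longrightarrow> a + G w \<in> B) \<longrightarrow> lower_gen_support D B l \<le> ereal (inner a l - m))"
proof -
  obtain w0 where w0: "a + G w0 \<in> D" using err by blast
  let ?e = "\<lambda>n::nat. inverse (real (Suc n))"
  have ep: "?e n > 0" "?e n \<le> 1" for n by (simp_all add: field_simps)
  have "\<exists>w l. a + G w \<in> D \<and> l \<in> limiting_normal D (a + G w) \<and> l \<in> N \<and>
     norm l \<le> 2 * \<kappa>0 * (norm c + ?e n * norm w) \<and>
     (\<forall>v. c v + ?e n * inner w v + inner l (G v) = 0) \<and>
     c w + ?e n / 2 * (norm w)\<^sup>2 \<le> c w0 + ?e n / 2 * (norm w0)\<^sup>2" for n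
    by (rule regularized_multiplier[OF D(1) w0 err \<kappa>0 ep(1) N])
  then obtain W L where W: "\<And>n. a + G (W n) \<in> D" "\<And>n. L n \<in> limiting_normal D (a + G (W n))"
     "\<And>n. L n \<in> N" "\<And>n. norm (L n) \<le> 2 * \<kappa>0 * (norm c + ?e n * norm (W n))"
     "\<And>n v. c v + ?e n * inner (W n) v + inner (L n) (G v) = 0"
     "\<And>n. c (W n) + ?e n / 2 * (norm (W n))\<^sup>2 \<le> c w0 + ?e n / 2 * (norm w0)\<^sup>2" by metis
  \<comment> \<open>Comparison of \<open>W n\<close> with \<open>w0\<close>, together with
    \<open>?e n \<le> 1\<close> and the lower bound \<open>m\<close> on \<open>c\<close>, bounds
    \<open>?e n\<close> times the squared norm of \<open>W n\<close>.\<close>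
  define C where "C = 2 * (c w0 + (norm w0)\<^sup>2 / 2 - m)"
  have eW: "?e n * (norm (W n))\<^sup>2 \<le> C" for n
  proof -
    have "?e n / 2 * (norm w0)\<^sup>2 \<le> (norm w0)\<^sup>2 / 2"
      using mult_right_mono[OF ep(2)[of n], of "(norm w0)\<^sup>2"] by simp
    then show ?thesis using W(6)[of n] m[OF W(1)[of n]] by (simp add: C_def)
  qed
  \<comment> \<open>The extra factor \<open>?e n\<close> makes the perturbation
    \<open>?e n *\<^sub>R W n\<close> of the stationarity equation vanish, even if
    \<open>W n\<close> is unbounded.\<close>
  have eW2: "(?e n * norm (W n))\<^sup>2 \<le> ?e n * C" for n
    using mult_left_mono[OF eW[of n], of "?e n"] ep(1)[of n]
    by (simp add: power2_eq_square mult_ac del: of_nat_Suc)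
  have "(\<lambda>n. (?e n * norm (W n))\<^sup>2) \<longlonglongrightarrow> 0"
  proof (rule Lim_null_comparison[OF always_eventually])
    show "\<forall>n. norm ((?e n * norm (W n))\<^sup>2) \<le> ?e n * C" using eW2 by (simp del: of_nat_Suc)
    show "(\<lambda>n. ?e n * C) \<longlonglongrightarrow> 0" using tendsto_mult[OF LIMSEQ_inverse_real_of_nat tendsto_const[of C]] by simp
  qed
  then have eW0: "(\<lambda>n. ?e n * norm (W n)) \<longlonglongrightarrow> 0" by simp
  then have "bounded (range (\<lambda>n. ?e n * norm (W n)))" using convergent_imp_bounded by blast
  then obtain M where "\<And>n. norm (?e n * norm (W n)) \<le> M" unfolding bounded_iff by blast
  then have M: "\<And>n. ?e n * norm (W n) \<le> M" by (metis abs_le_D1 real_norm_def)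
  have "L n \<in> cball 0 (2 * \<kappa>0 * (norm c + M))" for n
  proof -
    have "2 * \<kappa>0 * (norm c + ?e n * norm (W n)) \<le> 2 * \<kappa>0 * (norm c + M)"
      using M[of n] \<kappa>0 by (intro mult_left_mono add_left_mono) auto
    then show ?thesis using W(4)[of n] by (simp del: of_nat_Suc)
  qed
  then obtain l r where r: "strict_mono (r::nat\<Rightarrow>nat)" "(L \<circ> r) \<longlonglongrightarrow> l"
    using compact_cball[of "0::'b" "2 * \<kappa>0 * (norm c + M)"] unfolding compact_def by metis
  have Lr: "(\<lambda>n. L (r n)) \<longlonglongrightarrow> l" using r by (simp add: o_def)
  have "l \<in> N" by (rule closed_sequentially[OF N(1) _ Lr]) (use W in auto)
  moreover have "c v + inner (G v) l = 0" for v
  proof -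
    have "(\<lambda>n. ?e n * inner (W n) v) \<longlonglongrightarrow> 0"
    proof (rule Lim_null_comparison[OF always_eventually])
      show "\<forall>n. norm (?e n * inner (W n) v) \<le> ?e n * norm (W n) * norm v"
        using Cauchy_Schwarz_ineq2 ep(1) by (auto simp: abs_mult mult.assoc intro!: mult_left_mono)
      show "(\<lambda>n. ?e n * norm (W n) * norm v) \<longlonglongrightarrow> 0"
        using tendsto_mult[OF eW0 tendsto_const[of "norm v"]] by simp
    qed
    from LIMSEQ_subseq_LIMSEQ[OF this r(1)]
    have "(\<lambda>n. ?e (r n) * inner (W (r n)) v) \<longlonglongrightarrow> 0" by (simp add: o_def)
    then have "(\<lambda>n. c v + ?e (r n) * inner (W (r n)) v + inner (L (r n)) (G v)) \<longlonglongrightarrow> c v + 0 + inner l (G v)"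
      by (intro tendsto_intros Lr)
    then have "(\<lambda>n. 0::real) \<longlonglongrightarrow> c v + 0 + inner l (G v)" using W(5) by (simp only:)
    then show ?thesis using LIMSEQ_unique[OF tendsto_const[of 0]] by (simp add: inner_commute)
  qed
  moreover have "lower_gen_support D B l \<le> ereal (inner a l - m)" if B: "\<forall>w. a + G w \<in> D \<longrightarrow> a + G w \<in> B" for B
  proof (rule lower_gen_support_le[OF D(2) Lr, where us="\<lambda>n. a + G (W (r n))" and b="\<lambda>n. inner a (L (r n)) - m"])
    \<comment> \<open>Stationarity tested with \<open>v = W (r n)\<close> turns
      \<open>inner (L (r n)) (G (W (r n)))\<close> into \<open>- c (W (r n))\<close> minus a
      nonnegative term, and \<open>c\<close> is at least \<open>m\<close> on the constraint
      set.\<close>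
    show "inner (L (r n)) (a + G (W (r n))) \<le> inner a (L (r n)) - m" for n
    proof -
      have "?e (r n) * inner (W (r n)) (W (r n)) \<ge> 0" using ep(1)[of "r n"] by (intro mult_nonneg_nonneg) auto
      moreover have "inner (L (r n)) (a + G (W (r n))) = inner a (L (r n)) + inner (L (r n)) (G (W (r n)))"
        by (simp add: inner_add_right inner_commute)
      ultimately show ?thesis using W(5)[where n="r n" and v="W (r n)"] m[OF W(1)[of "r n"]] by linarith
    qed
    show "(\<lambda>n. inner a (L (r n)) - m) \<longlonglongrightarrow> inner a l - m" by (intro tendsto_intros Lr)
  qed (use W B in auto)
  ultimately show ?thesis by blast
qed

section \<open>Feasible curves under metric subregularity\<close>

lemma tangent_offset_tendsto:
  fixes d :: "'a::real_normed_vector"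
  assumes "t \<longlonglongrightarrow> 0" "(\<lambda>k. s k / t k) \<longlonglongrightarrow> 0" "ww \<longlonglongrightarrow> w" "\<And>k::nat. t k > (0::real)"
  shows "(\<lambda>k. x + t k *\<^sub>R d + s k *\<^sub>R ww k) \<longlonglongrightarrow> x"
proof -
  have "(\<lambda>k. x + t k *\<^sub>R d + (t k * (s k / t k)) *\<^sub>R ww k) \<longlonglongrightarrow> x + 0 *\<^sub>R d + (0 * 0) *\<^sub>R w"
    by (intro tendsto_intros assms)
  moreover have "t k * (s k / t k) = s k" for k using assms(4)[of k] by simp
  ultimately show ?thesis by simp
qed

text \<open>Only the tail of the sequences matters, so the curve may be confined to a given ball.\<close>

lemma scaled_tangentE_ball:
  assumes "w \<in> scaled_tangent \<gamma> A y v" "r > 0"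
  obtains t s ww where "\<And>k::nat. t k > 0" "\<And>k. s k > 0" "t \<longlonglongrightarrow> 0" "(\<lambda>k. s k / t k) \<longlonglongrightarrow> 0"
    "(\<lambda>k. (t k)\<^sup>2 / (2 * s k)) \<longlonglongrightarrow> \<gamma>" "ww \<longlonglongrightarrow> w"
    "\<And>k. y + t k *\<^sub>R v + s k *\<^sub>R ww k \<in> A"
    "\<And>k. norm (t k *\<^sub>R d + s k *\<^sub>R b) < r" "\<And>k. norm (t k *\<^sub>R v + s k *\<^sub>R ww k) < r"
proof -
  obtain t s ww where *: "\<And>k::nat. t k > 0" "\<And>k. s k > 0" "t \<longlonglongrightarrow> 0" "(\<lambda>k. s k / t k) \<longlonglongrightarrow> 0"
    "(\<lambda>k. (t k)\<^sup>2 / (2 * s k)) \<longlonglongrightarrow> \<gamma>" "ww \<longlonglongrightarrow> w"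
    "\<And>k. y + t k *\<^sub>R v + s k *\<^sub>R ww k \<in> A" using scaled_tangentE[OF assms(1)] by blast
  \<comment> \<open>Two increments are confined at once, possibly in different spaces: an auxiliary
    one with fixed \<open>d\<close> and \<open>b\<close>, used for the error bound, and that of the
    curve itself, used for quadratic growth.\<close>
  have "(\<lambda>k. norm (t k *\<^sub>R d + s k *\<^sub>R b)) \<longlonglongrightarrow> 0" "(\<lambda>k. norm (t k *\<^sub>R v + s k *\<^sub>R ww k)) \<longlonglongrightarrow> 0"
    using tangent_offset_tendsto[OF *(3,4) tendsto_const *(1), of 0 d b]
      tangent_offset_tendsto[OF *(3,4,6,1), of 0 v] by (auto intro: tendsto_norm_zero)
  then have "\<forall>\<^sub>F k in sequentially. norm (t k *\<^sub>R d + s k *\<^sub>R b) < r \<and> norm (t k *\<^sub>R v + s k *\<^sub>R ww k) < r"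
    using assms(2) by (intro eventually_conj order_tendstoD(2)) auto
  then obtain N where N: "\<And>k. k \<ge> N \<Longrightarrow> norm (t k *\<^sub>R d + s k *\<^sub>R b) < r \<and> norm (t k *\<^sub>R v + s k *\<^sub>R ww k) < r"
    unfolding eventually_sequentially by blast
  show ?thesis
    by (rule that[of "\<lambda>k. t (k + N)" "\<lambda>k. s (k + N)" "\<lambda>k. ww (k + N)"])
      (use * N in \<open>auto intro: LIMSEQ_ignore_initial_segment[of "\<lambda>k. s k / t k"]
        LIMSEQ_ignore_initial_segment[of "\<lambda>k. (t k)\<^sup>2 / (2 * s k)"] LIMSEQ_ignore_initial_segment\<close>)
qed

text \<open>The map \<open>g\<close> carries a feasible curve to a curve in \<open>K\<close> with
  the same scales, and the expansion identifies the limit of its second-order directions.\<close>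

lemma scaled_tangent_feasible_image:
  assumes g1: "\<And>x. (g has_derivative blinfun_apply (Dg x)) (at x)"
    and g2: "(Dg has_derivative blinfun_apply D2) (at x)"
    and w: "w \<in> scaled_tangent \<gamma> (feasible_set g K) x d"
  shows "\<gamma> *\<^sub>R D2 d d + Dg x w \<in> scaled_tangent \<gamma> K (g x) (Dg x d)"
proof -
  obtain t s ww where *: "\<And>k::nat. t k > 0" "\<And>k. s k > 0" "t \<longlonglongrightarrow> 0" "(\<lambda>k. s k / t k) \<longlonglongrightarrow> 0"
    "(\<lambda>k. (t k)\<^sup>2 / (2 * s k)) \<longlonglongrightarrow> \<gamma>" "ww \<longlonglongrightarrow> w"
    "\<And>k. x + t k *\<^sub>R d + s k *\<^sub>R ww k \<in> feasible_set g K" using scaled_tangentE[OF w] by blast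
  show ?thesis
  proof (rule scaled_tangentI[OF *(1-5)])
    show "(\<lambda>k. (1 / s k) *\<^sub>R (g (x + t k *\<^sub>R d + s k *\<^sub>R ww k) - g x - t k *\<^sub>R Dg x d))
       \<longlonglongrightarrow> \<gamma> *\<^sub>R D2 d d + Dg x w"
      using second_order_expansion[OF g1 g2 *(1-6), of d] by (simp only: add.commute)
    show "g x + t k *\<^sub>R Dg x d + s k *\<^sub>R (1 / s k) *\<^sub>R
        (g (x + t k *\<^sub>R d + s k *\<^sub>R ww k) - g x - t k *\<^sub>R Dg x d) \<in> K" for k
      using *(7)[of k] *(2)[of k] by (simp add: feasible_set_def)
  qed
qed

text \<open>Points of the trial curve with second-order direction \<open>w\<close> are projected
  onto the feasible set. Subregularity bounds the displacement, and division by \<open>s\<close>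
  transfers the modulus \<open>\<kappa>0\<close> unchanged to the tangent sets. When the right-hand
  side is 0, \<open>w\<close> itself is tangent, which is the converse of the image
  inclusion.\<close>

lemma scaled_tangent_error_bound:
  fixes g :: "'a::euclidean_space \<Rightarrow> 'b::euclidean_space"
  assumes g1: "\<And>x. (g has_derivative blinfun_apply (Dg x)) (at x)"
    and g2: "(Dg has_derivative blinfun_apply D2) (at x)"
    and K: "closed K" and x: "g x \<in> K" and r0: "r0 > 0" and \<kappa>0: "\<kappa>0 > 0"
    and sub: "\<And>y. y \<in> ball x r0 \<Longrightarrow> infdist y (feasible_set g K) \<le> \<kappa>0 * infdist (g y) K"
    and D: "scaled_tangent \<gamma> K (g x) (Dg x d) \<noteq> {}"
  shows "\<exists>w' \<in> scaled_tangent \<gamma> (feasible_set g K) x d.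
    norm (w' - w) \<le> \<kappa>0 * infdist (\<gamma> *\<^sub>R D2 d d + Dg x w) (scaled_tangent \<gamma> K (g x) (Dg x d))"
proof -
  let ?D = "scaled_tangent \<gamma> K (g x) (Dg x d)" and ?F = "feasible_set g K"
  define p where "p = \<gamma> *\<^sub>R D2 d d + Dg x w"
  \<comment> \<open>The nearest tangent vector \<open>u\<close> dictates the scales \<open>t\<close>
    and \<open>s\<close> at which the trial curve is sampled.\<close>
  obtain u where u: "u \<in> ?D" "infdist p ?D = dist p u"
    using infdist_attains_inf[OF closed_scaled_tangent D] by blast
  obtain t s uu where *: "\<And>k::nat. t k > 0" "\<And>k. s k > 0" "t \<longlonglongrightarrow> 0" "(\<lambda>k. s k / t k) \<longlonglongrightarrow> 0"
    "(\<lambda>k. (t k)\<^sup>2 / (2 * s k)) \<longlonglongrightarrow> \<gamma>" "uu \<longlonglongrightarrow> u"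
    "\<And>k. g x + t k *\<^sub>R Dg x d + s k *\<^sub>R uu k \<in> K"
    "\<And>k. norm (t k *\<^sub>R d + s k *\<^sub>R w) < r0" "\<And>k. norm (t k *\<^sub>R Dg x d + s k *\<^sub>R uu k) < r0"
    using scaled_tangentE_ball[OF u(1) r0, of d w] by blast
  define X where "X k = x + t k *\<^sub>R d + s k *\<^sub>R w" for k
  define v where "v k = (1 / s k) *\<^sub>R (g (X k) - g x - t k *\<^sub>R Dg x d)" for k
  have v: "v \<longlonglongrightarrow> p"
    unfolding v_def X_def p_def
    using second_order_expansion[OF g1 g2 *(1-5) tendsto_const[of w], of d] by (simp only: add.commute)
  have "continuous_on UNIV g" using g1 by (meson has_derivative_continuous_on has_derivative_at_withinI)
  from closed_vimage[OF K this] have F: "closed ?F" by (simp add: feasible_set_def vimage_def)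
  have "?F \<noteq> {}" using x by (auto simp: feasible_set_def)
  then have "\<exists>z. z \<in> ?F \<and> infdist (X k) ?F = dist (X k) z" for k
    using infdist_attains_inf[OF F, of "X k"] by blast
  then obtain z where z: "\<And>k. z k \<in> ?F" "\<And>k. infdist (X k) ?F = dist (X k) (z k)" by metis
  \<comment> \<open>The second-order direction of the projected point, so that cluster points of
    \<open>W\<close> are tangent to the feasible set.\<close>
  define W where "W k = (1 / s k) *\<^sub>R (z k - x - t k *\<^sub>R d)" for k
  have zW: "z k = x + t k *\<^sub>R d + s k *\<^sub>R W k" for k using *(2)[of k] by (simp add: W_def)
  have Wle: "norm (W k - w) \<le> \<kappa>0 * norm (v k - uu k)" for k
  proof -
    have "X k \<in> ball x r0" using *(8)[of k] by (simp add: X_def dist_norm norm_minus_commute algebra_simps)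
    then have "dist (X k) (z k) \<le> \<kappa>0 * infdist (g (X k)) K" using sub z(2) by metis
    also have "\<dots> \<le> \<kappa>0 * dist (g (X k)) (g x + t k *\<^sub>R Dg x d + s k *\<^sub>R uu k)"
      using \<kappa>0 by (intro mult_left_mono infdist_le *) auto
    also have "g (X k) = g x + t k *\<^sub>R Dg x d + s k *\<^sub>R v k" using *(2)[of k] by (simp add: v_def)
    also have "dist \<dots> (g x + t k *\<^sub>R Dg x d + s k *\<^sub>R uu k) = s k * norm (v k - uu k)"
      using *(2)[of k] by (simp add: dist_norm scaleR_diff_right[symmetric])
    also have "dist (X k) (z k) = s k * norm (W k - w)"
    proof -
      have "z k - X k = s k *\<^sub>R (W k - w)" by (simp add: zW X_def algebra_simps)
      then show ?thesis using *(2)[of k] by (simp add: dist_norm norm_minus_commute[of "X k"])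
    qed
    finally have "s k * norm (W k - w) \<le> s k * (\<kappa>0 * norm (v k - uu k))" by (simp add: mult_ac)
    then show ?thesis using *(2)[of k] by simp
  qed
  have lim: "(\<lambda>k. \<kappa>0 * norm (v k - uu k)) \<longlonglongrightarrow> \<kappa>0 * norm (p - u)"
    by (intro tendsto_intros v *)
  then have "bounded (range (\<lambda>k. \<kappa>0 * norm (v k - uu k)))" using convergent_imp_bounded by blast
  then obtain M where "\<And>k. norm (\<kappa>0 * norm (v k - uu k)) \<le> M" unfolding bounded_iff by blast
  then have "norm (W k - w) \<le> M" for k using Wle[of k] by (metis abs_le_D1 order_trans real_norm_def)
  then have "\<forall>k. W k \<in> cball w M" by (simp add: dist_norm norm_minus_commute)
  moreover have "seq_compact (cball w M)"
    unfolding compact_eq_seq_compact_metric[symmetric] by (rule compact_cball)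
  ultimately obtain w' r where r: "strict_mono (r::nat\<Rightarrow>nat)" "(W \<circ> r) \<longlonglongrightarrow> w'"
    by (elim seq_compactE)
  have "w' \<in> scaled_tangent \<gamma> ?F x d"
  proof (rule scaled_tangentI[of "t \<circ> r" "s \<circ> r" _ "W \<circ> r"])
    show "(t \<circ> r) \<longlonglongrightarrow> 0" by (rule LIMSEQ_subseq_LIMSEQ[OF *(3) r(1)])
    show "(\<lambda>k. (s \<circ> r) k / (t \<circ> r) k) \<longlonglongrightarrow> 0"
      using LIMSEQ_subseq_LIMSEQ[OF *(4) r(1)] by (simp add: o_def)
    show "(\<lambda>k. ((t \<circ> r) k)\<^sup>2 / (2 * (s \<circ> r) k)) \<longlonglongrightarrow> \<gamma>"
      using LIMSEQ_subseq_LIMSEQ[OF *(5) r(1)] by (simp add: o_def)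
  qed (use * r z(1) zW in \<open>auto simp: o_def\<close>)
  moreover have "norm (w' - w) \<le> \<kappa>0 * norm (p - u)"
    by (rule LIMSEQ_le[OF tendsto_norm[OF tendsto_diff[OF r(2) tendsto_const]]
          LIMSEQ_subseq_LIMSEQ[OF lim r(1)]]) (use Wle in auto)
  ultimately show ?thesis using u(2) unfolding p_def by (auto simp: dist_norm)
qed

section \<open>Quadratic growth\<close>

lemma infdist_lessD:
  assumes "infdist x A < r" "A \<noteq> {}"
  obtains a where "a \<in> A" "dist x a < r"
  using assms unfolding infdist_def by (auto simp: cINF_less_iff)

text \<open>Divide the growth inequality along the curve by \<open>s\<close>. Its right side
  contains \<open>t^2/s\<close> times the square of \<open>infdist (X k) S / t\<close>, and
  difference quotients of nearly nearest points of \<open>S\<close> cluster at a tangent direction,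
  so this ratio is asymptotically at least the distance from \<open>d\<close> to the tangent
  cone.\<close>

lemma quadratic_growth_second_order:
  fixes f :: "'a::euclidean_space \<Rightarrow> real"
  assumes f1: "\<And>x. (f has_derivative blinfun_apply (Df x)) (at x)"
    and f2: "(Df has_derivative blinfun_apply D2) (at x)"
    and x: "x \<in> S" and d: "Df x d \<le> 0" and \<kappa>: "\<kappa> > 0" and r0: "r0 > 0" and \<gamma>: "\<gamma> \<ge> 0"
    and growth: "\<And>y. y \<in> F \<Longrightarrow> y \<in> ball x r0 \<Longrightarrow> f x + \<kappa> * (infdist y S)\<^sup>2 \<le> f y"
    and w: "w \<in> scaled_tangent \<gamma> F x d"
  shows "2 * \<kappa> * \<gamma> * (infdist d (tangent_cone S x))\<^sup>2 \<le> Df x w + \<gamma> * D2 d d"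
proof -
  obtain t s ww where *: "\<And>k::nat. t k > 0" "\<And>k. s k > 0" "t \<longlonglongrightarrow> 0" "(\<lambda>k. s k / t k) \<longlonglongrightarrow> 0"
    "(\<lambda>k. (t k)\<^sup>2 / (2 * s k)) \<longlonglongrightarrow> \<gamma>" "ww \<longlonglongrightarrow> w"
    "\<And>k. x + t k *\<^sub>R d + s k *\<^sub>R ww k \<in> F" "\<And>k. norm (t k *\<^sub>R d + s k *\<^sub>R (0::'a)) < r0"
    "\<And>k. norm (t k *\<^sub>R d + s k *\<^sub>R ww k) < r0"
    using scaled_tangentE_ball[OF w r0, of d 0] by blast
  let ?e = "\<lambda>n::nat. inverse (real (Suc n))"
  define X where "X k = x + t k *\<^sub>R d + s k *\<^sub>R ww k" for k
  define p where "p k = d + (s k / t k) *\<^sub>R ww k" for k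
  have Xp: "X k = x + t k *\<^sub>R p k" for k using *(1)[of k] by (simp add: X_def p_def algebra_simps)
  have "p \<longlonglongrightarrow> d + 0 *\<^sub>R w" unfolding p_def by (intro tendsto_intros *)
  then have p: "p \<longlonglongrightarrow> d" by simp
  \<comment> \<open>Here \<open>S\<close> is arbitrary and nearest points may fail to exist; a
    tolerance of order smaller than \<open>t k\<close> does not affect the limit.\<close>
  have "\<exists>y. y \<in> S \<and> dist (X k) y < infdist (X k) S + t k * ?e k" for k
  proof -
    have "infdist (X k) S < infdist (X k) S + t k * ?e k" using *(1)[of k] by simp
    then show ?thesis using x by (metis empty_iff infdist_lessD)
  qed
  then obtain y where y: "\<And>k. y k \<in> S" "\<And>k. dist (X k) (y k) < infdist (X k) S + t k * ?e k" by metis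
  define i where "i k = infdist (X k) S / t k" for k
  have i0: "i k \<ge> 0" for k using *(1)[of k] by (simp add: i_def infdist_nonneg)
  define q where "q k = (1 / t k) *\<^sub>R (y k - x)" for k
  have yq: "y k = x + t k *\<^sub>R q k" for k using *(1)[of k] by (simp add: q_def)
  have pq: "norm (p k - q k) \<le> i k + ?e k" for k
  proof -
    have "X k - y k = t k *\<^sub>R (p k - q k)" by (simp add: Xp yq algebra_simps)
    then have "dist (X k) (y k) = t k * norm (p k - q k)" using *(1)[of k] by (simp add: dist_norm)
    moreover have "infdist (X k) S = t k * i k" using *(1)[of k] by (simp add: i_def)
    ultimately have "t k * norm (p k - q k) < t k * (i k + ?e k)" using y(2)[of k] by (simp add: distrib_left)
    then show ?thesis using *(1)[of k] by simp
  qed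
  have ip: "i k \<le> norm (p k)" for k
  proof -
    have "infdist (X k) S \<le> dist (X k) x" by (rule infdist_le[OF x])
    also have "\<dots> = t k * norm (p k)" using *(1)[of k] by (simp add: Xp dist_norm)
    finally show ?thesis using *(1)[of k] by (simp add: i_def field_simps)
  qed
  have "bounded (range p)" using p convergent_imp_bounded by blast
  then obtain M where M: "\<And>k. norm (p k) \<le> M" unfolding bounded_iff by blast
  have "q k \<in> cball 0 (M + M + 1)" for k
  proof -
    have "?e k \<le> 1" by (simp add: field_simps)
    then show ?thesis
      using norm_triangle_ineq3[of "q k" "p k"] M[of k] pq[of k] ip[of k]
      by (simp add: norm_minus_commute del: of_nat_Suc)
  qed
  then have "\<forall>k. q k \<in> cball 0 (M + M + 1)" ..
  moreover have "seq_compact (cball (0::'a) (M + M + 1))"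
    unfolding compact_eq_seq_compact_metric[symmetric] by (rule compact_cball)
  ultimately obtain q' r where r: "strict_mono (r::nat\<Rightarrow>nat)" "(q \<circ> r) \<longlonglongrightarrow> q'"
    by (elim seq_compactE)
  have "q' \<in> tangent_cone S x"
    unfolding tangent_cone_def
    using r *(1) LIMSEQ_subseq_LIMSEQ[OF *(3) r(1)] y(1) yq
    by (intro CollectI exI[of _ "t \<circ> r"] exI[of _ "q \<circ> r"]) auto
  then have dq: "infdist d (tangent_cone S x) \<le> norm (d - q')" using infdist_le by (metis dist_norm)
  \<comment> \<open>A convergent lower bound for \<open>i (r k)\<close>, whose own convergence is
    not established; the maximum with 0 makes squaring monotone.\<close>
  define j where "j k = max 0 (norm (p (r k) - q (r k)) - ?e (r k))" for k
  have pr: "(\<lambda>k. p (r k)) \<longlonglongrightarrow> d" and qr: "(\<lambda>k. q (r k)) \<longlonglongrightarrow> q'"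
    using LIMSEQ_subseq_LIMSEQ[OF p r(1)] r(2) by (simp_all add: o_def)
  have er: "(\<lambda>k. ?e (r k)) \<longlonglongrightarrow> 0"
    using LIMSEQ_subseq_LIMSEQ[OF LIMSEQ_inverse_real_of_nat r(1)] by (simp add: o_def)
  have tr: "(\<lambda>k. (t (r k))\<^sup>2 / (2 * s (r k))) \<longlonglongrightarrow> \<gamma>"
    using LIMSEQ_subseq_LIMSEQ[OF *(5) r(1)] by (simp add: o_def)
  have "j \<longlonglongrightarrow> max 0 (norm (d - q') - 0)" unfolding j_def
    by (intro tendsto_intros tendsto_max pr qr er)
  then have j: "j \<longlonglongrightarrow> norm (d - q')" by simp
  define b where "b k = (1 / s k) *\<^sub>R (f (X k) - f x - t k *\<^sub>R Df x d)" for k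
  have "b \<longlonglongrightarrow> Df x w + \<gamma> *\<^sub>R D2 d d"
    unfolding b_def X_def by (rule second_order_expansion[OF f1 f2 *(1-6)])
  from LIMSEQ_subseq_LIMSEQ[OF this r(1)]
  have br: "(\<lambda>k. b (r k)) \<longlonglongrightarrow> Df x w + \<gamma> * D2 d d" by (simp add: o_def)
  have "2 * \<kappa> * ((t (r k))\<^sup>2 / (2 * s (r k))) * (j k)\<^sup>2 \<le> b (r k)" for k
  proof -
    let ?k = "r k"
    have "j k \<le> i ?k" using pq[of ?k] i0[of ?k] by (simp add: j_def)
    then have "(j k)\<^sup>2 \<le> (i ?k)\<^sup>2" by (intro power_mono) (simp_all add: j_def)
    then have "2 * \<kappa> * ((t ?k)\<^sup>2 / (2 * s ?k)) * (j k)\<^sup>2 \<le> 2 * \<kappa> * ((t ?k)\<^sup>2 / (2 * s ?k)) * (i ?k)\<^sup>2"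
      using *(2)[of ?k] \<kappa> by (intro mult_left_mono) auto
    also have "\<dots> = (\<kappa> * (infdist (X ?k) S)\<^sup>2) / s ?k"
      using *(1)[of ?k] *(2)[of ?k] by (simp add: i_def power_divide)
    also have "\<dots> \<le> (f (X ?k) - f x - t ?k * Df x d) / s ?k"
    proof (rule divide_right_mono)
      have "dist (X ?k) x = norm (t ?k *\<^sub>R d + s ?k *\<^sub>R ww ?k)"
        by (simp add: X_def dist_norm add.assoc)
      then have "X ?k \<in> F" "X ?k \<in> ball x r0"
        using *(7)[of ?k] *(9)[of ?k] unfolding mem_ball dist_commute[of x "X ?k"]
        by (simp_all only: X_def)
      then have "\<kappa> * (infdist (X ?k) S)\<^sup>2 \<le> f (X ?k) - f x" using growth[of "X ?k"] by simp
      moreover have "t ?k * Df x d \<le> 0" using *(1)[of ?k] d by (simp add: mult_nonneg_nonpos)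
      ultimately show "\<kappa> * (infdist (X ?k) S)\<^sup>2 \<le> f (X ?k) - f x - t ?k * Df x d" by linarith
    qed (use *(2)[of ?k] in simp)
    finally show ?thesis by (simp add: b_def)
  qed
  moreover have "(\<lambda>k. 2 * \<kappa> * ((t (r k))\<^sup>2 / (2 * s (r k))) * (j k)\<^sup>2) \<longlonglongrightarrow> 2 * \<kappa> * \<gamma> * (norm (d - q'))\<^sup>2"
    by (intro tendsto_intros tr j)
  ultimately have "2 * \<kappa> * \<gamma> * (norm (d - q'))\<^sup>2 \<le> Df x w + \<gamma> * D2 d d"
    using LIMSEQ_le[OF _ br] by blast
  moreover have "2 * \<kappa> * \<gamma> * (infdist d (tangent_cone S x))\<^sup>2 \<le> 2 * \<kappa> * \<gamma> * (norm (d - q'))\<^sup>2"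
    using \<kappa> \<gamma> by (intro mult_left_mono power_mono dq infdist_nonneg) auto
  ultimately show ?thesis by linarith
qed

section \<open>Distance from approximate proximal normals to the tangent cone\<close>

text \<open>The quadratic bound for proximal normals, divided by \<open>t\<close>, still carries a
  factor \<open>t\<close> and vanishes in the limit.\<close>

lemma proximal_normal_tangent_cone_polar:
  assumes p: "p \<in> proximal_normal S x" and q: "q \<in> tangent_cone S x"
  shows "inner p q \<le> 0"
proof -
  obtain \<sigma> where \<sigma>: "\<sigma> > 0" "\<And>y. y \<in> S \<Longrightarrow> inner p (y - x) \<le> \<sigma> * (norm (y - x))\<^sup>2"
    using proximal_normal_inner_le[OF p] by blast
  obtain t dd where *: "\<And>k. t k > (0::real)" "t \<longlonglongrightarrow> 0" "dd \<longlonglongrightarrow> q" "\<And>k. x + t k *\<^sub>R dd k \<in> S"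
    using q unfolding tangent_cone_def by blast
  have "inner p (dd k) \<le> \<sigma> * (t k * (norm (dd k))\<^sup>2)" for k
  proof -
    have "t k * inner p (dd k) \<le> t k * (\<sigma> * (t k * (norm (dd k))\<^sup>2))"
      using \<sigma>(2)[OF *(4)[of k]] *(1)[of k] by (simp add: power_mult_distrib power2_eq_square mult_ac)
    then show ?thesis using *(1)[of k] by simp
  qed
  moreover have "(\<lambda>k. \<sigma> * (t k * (norm (dd k))\<^sup>2)) \<longlonglongrightarrow> \<sigma> * (0 * (norm q)\<^sup>2)" by (intro tendsto_intros *)
  moreover have "(\<lambda>k. inner p (dd k)) \<longlonglongrightarrow> inner p q" by (intro tendsto_intros *)
  ultimately show ?thesis using LIMSEQ_le[of "\<lambda>k. inner p (dd k)"] by force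
qed

text \<open>Let \<open>p\<close> be a proximal normal close to \<open>d\<close>. Polarity gives
  \<open>norm p \<le> norm (p - q)\<close> for tangent \<open>q\<close>; replacing \<open>p\<close>
  by \<open>d\<close> on each side costs \<open>dist d p\<close>, hence the factor 2 in front of
  \<open>\<epsilon>\<close>.\<close>

lemma eps_proximal_normal_tangent_dist:
  assumes x: "x \<in> S" and d: "d \<in> eps_proximal_normal S x \<epsilon>"
  shows "(1 - 2 * \<epsilon>) * norm d \<le> infdist d (tangent_cone S x)"
proof -
  have "(1 - 2 * \<epsilon>) * norm d \<le> dist d q" if q: "q \<in> tangent_cone S x" for q
  proof (rule field_le_epsilon)
    fix e :: real assume e: "e > 0"
    \<comment> \<open>The proximal normal cone need not be closed, so its distance to
      \<open>d\<close> may not be attained; the slack \<open>e / 2\<close> enters twice.\<close>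
    have "infdist d (proximal_normal S x) < \<epsilon> * norm d + e / 2"
      using d e unfolding eps_proximal_normal_def by simp
    then obtain p where p: "p \<in> proximal_normal S x" "dist d p < \<epsilon> * norm d + e / 2"
      using infdist_lessD zero_in_proximal_normal[OF x] by (metis empty_iff)
    have "(norm p)\<^sup>2 \<le> (norm (p - q))\<^sup>2"
      using proximal_normal_tangent_cone_polar[OF p(1) q] unfolding power2_norm_eq_inner
      by (simp add: inner_diff_left inner_diff_right inner_commute)
        (smt (verit) inner_ge_zero)
    then have "norm p \<le> norm (p - q)" by simp
    moreover have "norm (p - q) \<le> dist d p + dist d q"
      by (metis dist_commute dist_norm dist_triangle)
    moreover have "norm d \<le> norm p + dist d p" by (metis dist_norm norm_triangle_sub)
    ultimately show "(1 - 2 * \<epsilon>) * norm d \<le> dist d q + e" using p(2) by (simp add: algebra_simps)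
  qed
  \<comment> \<open>Needed because \<open>infdist\<close> to the empty set is 0 by
    convention.\<close>
  moreover have "tangent_cone S x \<noteq> {}"
  proof -
    have "0 \<in> tangent_cone S x" unfolding tangent_cone_def
      using x LIMSEQ_inverse_real_of_nat
      by (intro CollectI exI[of _ "\<lambda>k. inverse (real (Suc k))"] exI[of _ "\<lambda>_. 0"]) auto
    then show ?thesis by blast
  qed
  ultimately show ?thesis unfolding infdist_def by (auto intro!: cINF_greatest)
qed

section \<open>Multipliers for both parts of the theorem\<close>

text \<open>The linear program minimises \<open>Df x\<close> over second-order directions.
  Subregularity identifies its constraint set and gives its error bound, growth gives its lower
  bound, and proximal normals to the tangent set are directional normals to
  \<open>K\<close>.\<close>

lemma second_order_multiplier:
  fixes f :: "'a::euclidean_space \<Rightarrow> real" and g :: "'a \<Rightarrow> 'b::euclidean_space"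
  assumes f1: "\<And>x. (f has_derivative blinfun_apply (Df x)) (at x)"
    and f2: "(Df has_derivative blinfun_apply (D2f x)) (at x)"
    and g1: "\<And>x. (g has_derivative blinfun_apply (Dg x)) (at x)"
    and g2: "(Dg has_derivative blinfun_apply (D2g x)) (at x)"
    and K: "closed K" and x: "g x \<in> K" "x \<in> S" and d: "Df x d \<le> 0"
    and \<kappa>: "\<kappa> > 0" and r0: "r0 > 0" and \<kappa>0: "\<kappa>0 > 0" and \<gamma>: "\<gamma> \<ge> 0"
    and growth: "\<And>y. y \<in> feasible_set g K \<Longrightarrow> y \<in> ball x r0 \<Longrightarrow> f x + \<kappa> * (infdist y S)\<^sup>2 \<le> f y"
    and sub: "\<And>y. y \<in> ball x r0 \<Longrightarrow> infdist y (feasible_set g K) \<le> \<kappa>0 * infdist (g y) K"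
    and D: "scaled_tangent \<gamma> K (g x) (Dg x d) \<noteq> {}"
  shows "\<exists>l \<in> dir_multipliers Df g Dg K x d. \<forall>B.
    (\<lambda>u. Dg x u + \<gamma> *\<^sub>R D2g x d d) ` scaled_tangent \<gamma> (feasible_set g K) x d \<subseteq> B \<longrightarrow>
    lower_gen_support (scaled_tangent \<gamma> K (g x) (Dg x d)) B l
      \<le> ereal (\<gamma> * lagr_hess D2f D2g x l d - 2 * \<kappa> * \<gamma> * (infdist d (tangent_cone S x))\<^sup>2)"
proof -
  let ?D = "scaled_tangent \<gamma> K (g x) (Dg x d)" and ?F = "scaled_tangent \<gamma> (feasible_set g K) x d"
  let ?a = "\<gamma> *\<^sub>R D2g x d d"
  \<comment> \<open>The growth bound with the Hessian of \<open>f\<close> moved across; in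
    \<open>inner ?a l - ?m\<close> it joins the Hessian of \<open>g\<close> to form that of the
    Lagrangian.\<close>
  let ?m = "2 * \<kappa> * \<gamma> * (infdist d (tangent_cone S x))\<^sup>2 - \<gamma> * D2f x d d"
  note eb = scaled_tangent_error_bound[OF g1 g2 K x(1) r0 \<kappa>0 sub D]
  have F: "w \<in> ?F" if "?a + Dg x w \<in> ?D" for w
    using eb[of w] that by auto
  have "\<exists>l\<in>dir_normal K (g x) (Dg x d). (\<forall>v. Df x v + inner (Dg x v) l = 0) \<and>
    (\<forall>B. (\<forall>w. ?a + Dg x w \<in> ?D \<longrightarrow> ?a + Dg x w \<in> B) \<longrightarrow>
      lower_gen_support ?D B l \<le> ereal (inner ?a l - ?m))"
  proof (rule linear_program_multiplier[OF closed_scaled_tangent D _ \<kappa>0 closed_dir_normal])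
    show "\<exists>w'. ?a + Dg x w' \<in> ?D \<and> norm (w' - w) \<le> \<kappa>0 * infdist (?a + Dg x w) ?D" for w
      using eb[of w] scaled_tangent_feasible_image[OF g1 g2] by blast
    show "proximal_normal ?D u \<subseteq> dir_normal K (g x) (Dg x d)" for u
      using proximal_normal_scaled_tangent_subset[OF K] by blast
    show "?m \<le> Df x w" if "?a + Dg x w \<in> ?D" for w
      using quadratic_growth_second_order[OF f1 f2 x(2) d \<kappa> r0 \<gamma> growth F[OF that]] by simp
  qed
  then obtain l where l: "l \<in> dir_normal K (g x) (Dg x d)" "\<And>v. Df x v + inner (Dg x v) l = 0"
    "\<And>B. (\<forall>w. ?a + Dg x w \<in> ?D \<longrightarrow> ?a + Dg x w \<in> B) \<Longrightarrow>
      lower_gen_support ?D B l \<le> ereal (inner ?a l - ?m)" by blast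
  have "inner ?a l - ?m = \<gamma> * lagr_hess D2f D2g x l d - 2 * \<kappa> * \<gamma> * (infdist d (tangent_cone S x))\<^sup>2"
    by (simp add: lagr_hess_def algebra_simps)
  moreover have "?a + Dg x w \<in> B" if "(\<lambda>u. Dg x u + ?a) ` ?F \<subseteq> B" "?a + Dg x w \<in> ?D" for B w
    using that(1) F[OF that(2)] by (auto simp: add.commute)
  moreover have "l \<in> dir_multipliers Df g Dg K x d" using l(1,2) by (simp add: dir_multipliers_def)
  ultimately show ?thesis using l(3) by metis
qed

lemma ereal_diff_ge_of_le_diff:
  assumes "\<sigma> \<le> ereal (h - b)"
  shows "ereal h - \<sigma> \<ge> ereal b"
  using assms by (cases \<sigma>) auto

theorem theorem3p8:
  fixes f :: "'a::euclidean_space \<Rightarrow> real" and g :: "'a \<Rightarrow> 'b::euclidean_space"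
    and Df :: "'a \<Rightarrow> 'a \<Rightarrow>\<^sub>L real" and D2f :: "'a \<Rightarrow> 'a \<Rightarrow>\<^sub>L 'a \<Rightarrow>\<^sub>L real"
    and Dg :: "'a \<Rightarrow> 'a \<Rightarrow>\<^sub>L 'b" and D2g :: "'a \<Rightarrow> 'a \<Rightarrow>\<^sub>L 'a \<Rightarrow>\<^sub>L 'b"
    and K :: "'b set" and xb :: 'a and \<kappa> \<delta> \<epsilon> :: real
  assumes f1: "\<And>x. (f has_derivative blinfun_apply (Df x)) (at x)"
    and f2: "\<And>x. (Df has_derivative blinfun_apply (D2f x)) (at x)"
    and f2c: "continuous_on UNIV D2f"
    and g1: "\<And>x. (g has_derivative blinfun_apply (Dg x)) (at x)"
    and g2: "\<And>x. (Dg has_derivative blinfun_apply (D2g x)) (at x)"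
    and g2c: "continuous_on UNIV D2g"
    and Kcl: "closed K"
    and Sne: "optimal_set f g K \<noteq> {}"
    and sharp: "so_weak_sharp_min f g K xb \<kappa> \<delta>"
    and mscq: "MSCQ g K xb"
    and eps: "0 \<le> \<epsilon>" "\<epsilon> < 1/2"
  shows "\<exists>\<delta>'. 0 < \<delta>' \<and> \<delta>' < \<delta> \<and>
    (\<forall>x \<in> optimal_set f g K \<inter> ball xb \<delta>'.
      \<forall>d \<in> crit_cone Df g Dg K x \<inter> eps_proximal_normal (optimal_set f g K) x \<epsilon>.
        (\<exists>l \<in> dir_multipliers Df g Dg K x d.
           (\<forall>A. Theta_set g Dg K x d \<subseteq> A \<longrightarrow>
              lower_gen_support (asymp_second_tangent K (g x) (Dg x d)) A l \<le> 0)
           \<and> lower_gen_support (asymp_second_tangent K (g x) (Dg x d)) UNIV l \<le> 0)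
        \<and> (second_tangent K (g x) (Dg x d) \<noteq> {} \<longrightarrow>
           (\<exists>l \<in> dir_multipliers Df g Dg K x d.
              (\<forall>B. Omega_set g Dg D2g K x d \<subseteq> B \<longrightarrow>
                 ereal (lagr_hess D2f D2g x l d) - lower_gen_support (second_tangent K (g x) (Dg x d)) B l
                   \<ge> ereal (2 * \<kappa> * (1 - 2 * \<epsilon>)\<^sup>2 * (norm d)\<^sup>2))
              \<and> ereal (lagr_hess D2f D2g x l d) - lower_gen_support (second_tangent K (g x) (Dg x d)) UNIV l
                   \<ge> ereal (2 * \<kappa> * (1 - 2 * \<epsilon>)\<^sup>2 * (norm d)\<^sup>2))))
    \<and> (\<forall>x \<in> optimal_set f g K \<inter> ball xb \<delta>'.
      \<forall>d \<in> crit_cone Df g Dg K x.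
        (\<exists>l \<in> dir_multipliers Df g Dg K x d.
           (\<forall>A. Theta_set g Dg K x d \<subseteq> A \<longrightarrow>
              lower_gen_support (asymp_second_tangent K (g x) (Dg x d)) A l \<le> 0)
           \<and> lower_gen_support (asymp_second_tangent K (g x) (Dg x d)) UNIV l \<le> 0)
        \<and> (second_tangent K (g x) (Dg x d) \<noteq> {} \<longrightarrow>
           (\<exists>l \<in> dir_multipliers Df g Dg K x d.
              (\<forall>B. Omega_set g Dg D2g K x d \<subseteq> B \<longrightarrow>
                 ereal (lagr_hess D2f D2g x l d) - lower_gen_support (second_tangent K (g x) (Dg x d)) B l
                   \<ge> ereal (2 * \<kappa> * (infdist d (tangent_cone (optimal_set f g K) x))\<^sup>2))
              \<and> ereal (lagr_hess D2f D2g x l d) - lower_gen_support (second_tangent K (g x) (Dg x d)) UNIV l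
                   \<ge> ereal (2 * \<kappa> * (infdist d (tangent_cone (optimal_set f g K) x))\<^sup>2))))"
proof -
  let ?S = "optimal_set f g K" and ?F = "feasible_set g K"
  have \<kappa>: "\<kappa> > 0" and \<delta>: "\<delta> > 0"
    and growth: "\<And>y. y \<in> ?F \<Longrightarrow> y \<in> ball xb \<delta> \<Longrightarrow> f y \<ge> f xb + \<kappa> * (infdist y ?S)\<^sup>2"
    and xb: "xb \<in> ?F"
    using sharp unfolding so_weak_sharp_min_def by auto
  obtain \<delta>0 \<kappa>0 where sub: "\<delta>0 > 0" "\<kappa>0 > 0"
    "\<And>y. y \<in> ball xb \<delta>0 \<Longrightarrow> infdist y ?F \<le> \<kappa>0 * infdist (g y) K"
    using mscq unfolding MSCQ_def by blast
  \<comment> \<open>Halving lets \<open>\<delta>'\<close> serve twice: for \<open>x\<close> within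
    \<open>\<delta>'\<close> of \<open>xb\<close>, the ball of radius \<open>\<delta>'\<close>
    around \<open>x\<close> stays inside the balls for growth and for subregularity.\<close>
  define \<delta>' where "\<delta>' = min \<delta> \<delta>0 / 2"
  have \<delta>': "\<delta>' > 0" "\<delta>' < \<delta>" using \<delta> sub(1) by (auto simp: \<delta>'_def)
  have mult: "\<exists>l \<in> dir_multipliers Df g Dg K x d. \<forall>B.
      (\<lambda>u. Dg x u + \<gamma> *\<^sub>R D2g x d d) ` scaled_tangent \<gamma> ?F x d \<subseteq> B \<longrightarrow>
      lower_gen_support (scaled_tangent \<gamma> K (g x) (Dg x d)) B l
        \<le> ereal (\<gamma> * lagr_hess D2f D2g x l d - 2 * \<kappa> * \<gamma> * (infdist d (tangent_cone ?S x))\<^sup>2)"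
    if x: "x \<in> ?S \<inter> ball xb \<delta>'" and d: "d \<in> crit_cone Df g Dg K x" and \<gamma>: "\<gamma> \<ge> 0"
      and D: "scaled_tangent \<gamma> K (g x) (Dg x d) \<noteq> {}" for x d \<gamma>
  proof (rule second_order_multiplier[where D2f=D2f and D2g=D2g and x=x, OF f1 f2 g1 g2 Kcl _ _ _ \<kappa> \<delta>'(1) sub(2) \<gamma> _ _ D])
    have in_balls: "y \<in> ball xb \<delta>" "y \<in> ball xb \<delta>0" if "y \<in> ball x \<delta>'" for y
      using that x dist_triangle[of xb y x] by (auto simp: \<delta>'_def)
    \<comment> \<open>Optimality of \<open>x\<close> moves the growth condition from base point
      \<open>xb\<close> to base point \<open>x\<close>.\<close>
    have "f x \<le> f xb" using x xb unfolding optimal_set_def feasible_set_def by auto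
    then show "f x + \<kappa> * (infdist y ?S)\<^sup>2 \<le> f y" if "y \<in> ?F" "y \<in> ball x \<delta>'" for y
      using growth[OF that(1) in_balls(1)[OF that(2)]] by linarith
    show "infdist y ?F \<le> \<kappa>0 * infdist (g y) K" if "y \<in> ball x \<delta>'" for y
      using sub(3)[OF in_balls(2)[OF that]] .
  qed (use x d in \<open>auto simp: optimal_set_def crit_cone_def\<close>)
  have i: "\<exists>l \<in> dir_multipliers Df g Dg K x d.
           (\<forall>A. Theta_set g Dg K x d \<subseteq> A \<longrightarrow>
              lower_gen_support (asymp_second_tangent K (g x) (Dg x d)) A l \<le> 0)
           \<and> lower_gen_support (asymp_second_tangent K (g x) (Dg x d)) UNIV l \<le> 0"
    if x: "x \<in> ?S \<inter> ball xb \<delta>'" and d: "d \<in> crit_cone Df g Dg K x" for x d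
  proof -
    have "scaled_tangent 0 K (g x) (Dg x d) \<noteq> {}"
      using d zero_in_scaled_tangent_0 unfolding crit_cone_def by blast
    \<comment> \<open>At \<open>\<gamma> = 0\<close> the Hessian and the distance term both drop
      out, leaving the bound 0.\<close>
    from mult[OF x d _ this] show ?thesis
      by (auto simp: Theta_set_def asymp_second_tangent_eq zero_ereal_def)
  qed
  \<comment> \<open>The free bound \<open>b\<close> covers both right-hand sides of part (ii), since
    \<open>prox\<close> compares the first with the second.\<close>
  have ii: "\<exists>l \<in> dir_multipliers Df g Dg K x d.
              (\<forall>B. Omega_set g Dg D2g K x d \<subseteq> B \<longrightarrow>
                 ereal (lagr_hess D2f D2g x l d) - lower_gen_support (second_tangent K (g x) (Dg x d)) B l
                   \<ge> ereal b)
              \<and> ereal (lagr_hess D2f D2g x l d) - lower_gen_support (second_tangent K (g x) (Dg x d)) UNIV l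
                   \<ge> ereal b"
    if x: "x \<in> ?S \<inter> ball xb \<delta>'" and d: "d \<in> crit_cone Df g Dg K x"
      and ne: "second_tangent K (g x) (Dg x d) \<noteq> {}"
      and b: "b \<le> 2 * \<kappa> * (infdist d (tangent_cone ?S x))\<^sup>2" for x d b
  proof -
    obtain l where l: "l \<in> dir_multipliers Df g Dg K x d" "\<And>B. Omega_set g Dg D2g K x d \<subseteq> B \<Longrightarrow>
        lower_gen_support (second_tangent K (g x) (Dg x d)) B l
        \<le> ereal (lagr_hess D2f D2g x l d - 2 * \<kappa> * (infdist d (tangent_cone ?S x))\<^sup>2)"
      using mult[OF x d, of 1] ne by (auto simp: Omega_set_def second_tangent_eq)
    have "ereal (lagr_hess D2f D2g x l d) - lower_gen_support (second_tangent K (g x) (Dg x d)) B l \<ge> ereal b"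
      if "Omega_set g Dg D2g K x d \<subseteq> B" for B
      using ereal_diff_ge_of_le_diff[OF l(2)[OF that]] b by (meson ereal_less_eq(3) order_trans)
    then show ?thesis using l(1) by blast
  qed
  have prox: "2 * \<kappa> * (1 - 2 * \<epsilon>)\<^sup>2 * (norm d)\<^sup>2 \<le> 2 * \<kappa> * (infdist d (tangent_cone ?S x))\<^sup>2"
    if "x \<in> ?S" "d \<in> eps_proximal_normal ?S x \<epsilon>" for x d
  proof -
    \<comment> \<open>Squaring preserves the inequality because \<open>\<epsilon> < 1/2\<close>
      makes the left factor positive.\<close>
    have "((1 - 2 * \<epsilon>) * norm d)\<^sup>2 \<le> (infdist d (tangent_cone ?S x))\<^sup>2"
      using eps by (intro power_mono eps_proximal_normal_tangent_dist that) auto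
    then have "2 * \<kappa> * ((1 - 2 * \<epsilon>) * norm d)\<^sup>2 \<le> 2 * \<kappa> * (infdist d (tangent_cone ?S x))\<^sup>2"
      using \<kappa> by (intro mult_left_mono) auto
    then show ?thesis by (simp add: power_mult_distrib mult.assoc)
  qed
  show ?thesis
    by (intro exI[of _ \<delta>'] conjI ballI impI \<delta>') (use i ii prox in \<open>blast+\<close>)
qed

end
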